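(* For every integer $d \geq 3$, the Jensen polynomial $J_{\overline{a}}^{d,n}(X)$ is hyperbolic (i.e. has only real roots) for all but finitely many nonnegative integers $n$.
   Context: The cubic overpartition function $\overline{a}(n)$ is defined by $\sum_{n\ge 0}\overline{a}(n)q^n=\frac{(-q;q)_\infty(-q^2;q^2)_\infty}{(q;q)_\infty(q^2;q^2)_\infty}$ for $|q|<1$, where $(a;q)_\infty=\prod_{j\ge 0}(1-aq^j)$. For a real sequence $t(n)$, the Jensen polynomial of degree $d$ and shift $n$ is $J_t^{d,n}(X)=\sum_{i=0}^d\binom{d}{i}t(n+i)X^i$. *)

theory Defs
  imports "HOL-Analysis.Analysis" "HOL-Computational_Algebra.Polynomial"
begin

definition qpoch_inf :: "real \<Rightarrow> real \<Rightarrow> real" where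
  "qpoch_inf a q = (\<Prod>j. 1 - a * q ^ j)"

definition cubic_gf :: "real \<Rightarrow> real" where
  "cubic_gf q = qpoch_inf (- q) q * qpoch_inf (- (q^2)) (q^2)
              / (qpoch_inf q q * qpoch_inf (q^2) (q^2))"

definition cubic_overpartition :: "nat \<Rightarrow> real" where
  "cubic_overpartition = (THE a. \<forall>q::real. \<bar>q\<bar> < 1 \<longrightarrow> (\<lambda>n. a n * q ^ n) sums cubic_gf q)"

definition jensen_poly :: "(nat \<Rightarrow> real) \<Rightarrow> nat \<Rightarrow> nat \<Rightarrow> real poly" where
  "jensen_poly t d n = (\<Sum>i\<le>d. monom (of_nat (d choose i) * t (n + i)) i)"

definition hyperbolic :: "real poly \<Rightarrow> bool" where
  "hyperbolic p \<longleftrightarrow> (\<forall>z::complex. poly (map_poly complex_of_real p) z = 0 \<longrightarrow> z \<in> \<real>)"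

end

theory Submission
  imports Defs "HOL-Probability.Probability" "HOL-Complex_Analysis.Complex_Analysis"
begin

text \<open>The generating function is \<open>exp\<close> of a power series with nonnegative coefficients, so Cauchy's
  formula on the circle of radius \<open>r = exp (- \<tau>)\<close> writes the Jensen polynomial as an integral of
  \<open>F(z) z\<^sup>-\<^sup>n (1 + X / z)\<^sup>d\<close>. Take \<open>r\<close> to be the saddle point, let \<open>V\<close> be the second derivative of
  \<open>ln F (exp (- \<tau>))\<close> in \<open>\<tau>\<close>, and rescale by \<open>s = 1 / sqrt V\<close>: for \<open>X = - r (1 - s y)\<close> and \<open>t = s u\<close>
  the integrand tends, with an integrable majorant, to \<open>exp (- u\<^sup>2 / 2) (y + \<i> u)\<^sup>d\<close>, whose integral is a
  positive multiple of the Hermite polynomial \<open>He\<^sub>d(y)\<close>. Since \<open>He\<^sub>d\<close> alternates in sign at \<open>d + 1\<close>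
  points, so does the Jensen polynomial for all large \<open>n\<close>, and hence it has \<open>d\<close> real roots.\<close>

section \<open>Hermite polynomials and sign changes\<close>

text \<open>Only crude information about the logarithm is used. Its Taylor coefficients of positive
  index are all at least 2, and the \<open>p\<close>-th moment is at most a constant times
  \<tau>^-(p+1). Hence \<open>V\<close> has exact order \<tau>^-3 and \<open>s\<close> exact order
  \<tau>^(3/2), so the cubic error term of the expansion is of size \<tau>^-4 * s^3, that is sqrt
  \<tau>, and vanishes in the limit. The obstacle is the part of the circle far from the saddle
  point: the expansion says nothing there, yet dominated convergence needs a majorant. Since all
  coefficients are nonnegative, the drop of |F| below F(r) can be compared with that of a geometric
  series, which is explicit on the whole circle. The choice of \<open>X\<close> is forced by scale:
  near the saddle point the factor 1 + X / z is of order \<open>s\<close> exactly when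
  \<open>X\<close> lies within order \<open>s\<close> of \<open>- r\<close>, so this is the window
  in which the roots are caught.\<close>

fun hermite :: "nat \<Rightarrow> real poly" where
  "hermite 0 = 1"
| "hermite (Suc d) = [:0, 1:] * hermite d - pderiv (hermite d)"

lemma pderiv_hermite_Suc: "pderiv (hermite (Suc d)) = of_nat (Suc d) * hermite d"
proof (induction d)
  case 0
  show ?case by (simp add: pderiv_pCons)
next
  case (Suc d)
  have "pderiv (hermite (Suc (Suc d))) =
        hermite (Suc d) + [:0, 1:] * pderiv (hermite (Suc d)) - pderiv (pderiv (hermite (Suc d)))"
    by (simp add: pderiv_diff pderiv_mult pderiv_pCons algebra_simps del: hermite.simps(2) add: hermite.simps(2)[of "Suc d"])
  also have "pderiv (pderiv (hermite (Suc d))) = of_nat (Suc d) * pderiv (hermite d)"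
    unfolding Suc by (simp add: pderiv_mult pderiv_of_nat del: of_nat_Suc)
  also have "hermite (Suc d) + [:0, 1:] * pderiv (hermite (Suc d)) - of_nat (Suc d) * pderiv (hermite d)
      = hermite (Suc d) + of_nat (Suc d) * ([:0, 1:] * hermite d - pderiv (hermite d))"
    unfolding Suc by (simp add: algebra_simps)
  also have "\<dots> = hermite (Suc d) + of_nat (Suc d) * hermite (Suc d)" by simp
  also have "\<dots> = of_nat (Suc (Suc d)) * hermite (Suc d)"
    by (simp add: algebra_simps del: hermite.simps)
  finally show ?case .
qed

text \<open>The Appell property of \<open>pderiv_hermite_Suc\<close> turns the derivative recursion
  into the three-term one, which is the form in which Gaussian integrals reproduce it.\<close>

lemma hermite_Suc_Suc:
  "hermite (Suc (Suc d)) = [:0, 1:] * hermite (Suc d) - of_nat (Suc d) * hermite d"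
  using pderiv_hermite_Suc[of d] by (subst hermite.simps(2)) (simp del: hermite.simps)

lemma poly_times_gaussian_tendsto_0_at_top:
  "((\<lambda>y. poly p y * exp (- y\<^sup>2 / 2)) \<longlongrightarrow> 0) at_top" for p :: "real poly"
proof -
  have "((\<lambda>y. coeff p i * (y ^ i * exp (- y\<^sup>2 / 2))) \<longlongrightarrow> coeff p i * 0) at_top" for i
    by (intro tendsto_mult tendsto_const) real_asymp
  then have "((\<lambda>y. \<Sum>i\<le>degree p. coeff p i * (y ^ i * exp (- y\<^sup>2 / 2))) \<longlongrightarrow> (\<Sum>i\<le>degree p. 0)) at_top"
    by (intro tendsto_sum) simp
  then show ?thesis by (simp add: poly_altdef sum_distrib_right mult.assoc)
qed

lemma poly_times_gaussian_tendsto_0_at_bot: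
  "((\<lambda>y. poly p y * exp (- y\<^sup>2 / 2)) \<longlongrightarrow> 0) at_bot" for p :: "real poly"
  using poly_times_gaussian_tendsto_0_at_top[of "pcompose p [:0, -1:]"]
  by (simp add: filterlim_at_bot_mirror poly_pcompose)

lemma hermite_gaussian_deriv:
  "((\<lambda>y. poly (hermite d) y * exp (- y\<^sup>2 / 2)) has_real_derivative
     - (poly (hermite (Suc d)) y * exp (- y\<^sup>2 / 2))) (at y)"
  by (auto intro!: derivative_eq_intros poly_DERIV simp: algebra_simps)

text \<open>By Rolle's argument on \<open>hermite d\<close> times the Gaussian, which decays at both ends, each
  derivative gains one sign change.\<close>
lemma hermite_alternating:
  "\<exists>y::nat \<Rightarrow> real. (\<forall>i<d. y i < y (Suc i)) \<and> (\<forall>i\<le>d. (-1) ^ (d + i) * poly (hermite d) (y i) > 0)"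
proof (induction d)
  case 0
  show ?case by auto
next
  case (Suc d)
  then obtain y where y: "\<And>i. i < d \<Longrightarrow> y i < y (Suc i)"
    and alt: "\<And>i. i \<le> d \<Longrightarrow> (-1) ^ (d + i) * poly (hermite d) (y i) > 0" by blast
  define g where "g = (\<lambda>y. poly (hermite d) y * exp (- y\<^sup>2 / 2))"
  have galt: "(-1) ^ (d + i) * g (y i) > 0" if "i \<le> d" for i
    using alt[OF that] by (simp add: g_def mult.assoc[symmetric])
  have g_nz: "\<bar>g (y i)\<bar> > 0" if "i \<le> d" for i
    using galt[OF that] by auto
  have "\<forall>\<^sub>F x in at_bot. \<bar>g x\<bar> < \<bar>g (y 0)\<bar>"
    using order_tendstoD(2)[OF tendsto_rabs_zero[OF poly_times_gaussian_tendsto_0_at_bot[of "hermite d"]],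
        of "\<bar>g (y 0)\<bar>"] g_nz[of 0] by (simp add: g_def)
  moreover have "\<forall>\<^sub>F x in at_bot. x < y 0" by (rule eventually_gt_at_bot)
  ultimately have "\<forall>\<^sub>F x in at_bot. \<bar>g x\<bar> < \<bar>g (y 0)\<bar> \<and> x < y 0" by eventually_elim auto
  then obtain a where a: "\<bar>g a\<bar> < \<bar>g (y 0)\<bar>" "a < y 0"
    using eventually_happens'[OF trivial_limit_at_bot_linorder] by blast
  have "\<forall>\<^sub>F x in at_top. \<bar>g x\<bar> < \<bar>g (y d)\<bar>"
    using order_tendstoD(2)[OF tendsto_rabs_zero[OF poly_times_gaussian_tendsto_0_at_top[of "hermite d"]],
        of "\<bar>g (y d)\<bar>"] g_nz[of d] by (simp add: g_def)
  moreover have "\<forall>\<^sub>F x in at_top. x > y d" by (rule eventually_gt_at_top)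
  ultimately have "\<forall>\<^sub>F x in at_top. \<bar>g x\<bar> < \<bar>g (y d)\<bar> \<and> x > y d" by eventually_elim auto
  then obtain b where b: "\<bar>g b\<bar> < \<bar>g (y d)\<bar>" "b > y d"
    using eventually_happens'[OF trivial_limit_at_top_linorder] by blast
  \<comment> \<open>The old points with one more at each end, \<open>d + 3\<close> in all; their
    \<open>d + 2\<close> gaps supply the \<open>d + 2\<close> points required for
    \<open>Suc d\<close>.\<close>
  define w where "w = (\<lambda>i. if i = 0 then a else if i = Suc (Suc d) then b else y (i - 1))"
  have w_less: "w i < w (Suc i)" if "i \<le> Suc d" for i
    using that a(2) b(2) y[of "i - 1"] by (auto simp: w_def)
  \<comment> \<open>In the two outer gaps |\<open>g\<close>| is smaller at the added end point than
    at its neighbour, so the neighbour alone decides the sign of the increment.\<close>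
  have w_alt: "(-1) ^ (d + i) * (g (w (Suc i)) - g (w i)) > 0" if "i \<le> Suc d" for i
  proof (cases "i = 0 \<or> i = Suc d")
    case True
    then show ?thesis
    proof
      assume "i = 0"
      with galt[of 0] a(1) show ?thesis
        by (cases "even d") (auto simp: w_def)
    next
      assume "i = Suc d"
      with galt[of d] b(1) show ?thesis
        by (auto simp: w_def mult_2[symmetric] power_mult)
    qed
  next
    case False
    then obtain j where "i = Suc j" using not0_implies_Suc by blast
    moreover from this have "j < d" using that False by simp
    ultimately have j: "i = Suc j" "j < d" .
    have "g (w i) = g (y j)" "g (w (Suc i)) = g (y (Suc j))" using j by (auto simp: w_def)
    then show ?thesis using galt[of j] galt[of "Suc j"] j
      by (simp add: algebra_simps)
  qed
  have "\<exists>z. w i < z \<and> z < w (Suc i) \<and> (-1) ^ (Suc d + i) * poly (hermite (Suc d)) z > 0"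
    if i: "i \<le> Suc d" for i
  proof -
    obtain z where z: "z > w i" "z < w (Suc i)"
      "g (w (Suc i)) - g (w i) = (w (Suc i) - w i) * (- (poly (hermite (Suc d)) z * exp (- z\<^sup>2 / 2)))"
      using MVT2[OF w_less[OF i], of g "\<lambda>z. - (poly (hermite (Suc d)) z * exp (- z\<^sup>2 / 2))"]
        hermite_gaussian_deriv[of d] unfolding g_def by blast
    have "0 < (-1) ^ (d + i) * (g (w (Suc i)) - g (w i))" by (rule w_alt[OF i])
    also have "\<dots> = ((w (Suc i) - w i) * exp (- z\<^sup>2 / 2)) * ((-1) ^ (Suc d + i) * poly (hermite (Suc d)) z)"
      unfolding z(3) by (simp del: hermite.simps)
    finally have "(-1) ^ (Suc d + i) * poly (hermite (Suc d)) z > 0"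
      using w_less[OF i] by (subst (asm) zero_less_mult_iff) (auto simp: zero_less_mult_iff mult_less_0_iff simp del: hermite.simps)
    with z show ?thesis by blast
  qed
  then obtain z where z: "\<And>i. i \<le> Suc d \<Longrightarrow> w i < z i \<and> z i < w (Suc i) \<and>
      (-1) ^ (Suc d + i) * poly (hermite (Suc d)) (z i) > 0" by metis
  have "z i < z (Suc i)" if "i < Suc d" for i
    using z[of i] z[of "Suc i"] that by force
  with z show ?case by (intro exI[of _ z]) (auto simp del: hermite.simps)
qed

lemma poly_map_poly_of_real:
  "poly (map_poly of_real p) (of_real x :: complex) = of_real (poly p x)"
  by (simp add: poly_altdef degree_map_poly coeff_map_poly)

text \<open>The intermediate value theorem puts a root in each of \<open>d\<close> disjoint
  intervals, and a nonzero polynomial of degree at most \<open>d\<close> has no further complex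
  roots. With \<open>d > 0\<close> the sign condition is not vacuous and excludes
  \<open>p = 0\<close>.\<close>

lemma hyperbolicI_alternating:
  assumes deg: "degree p \<le> d" and d: "d > 0"
    and y: "\<And>i. i < d \<Longrightarrow> y i < y (Suc i)"
    and alt: "\<And>i. i < d \<Longrightarrow> poly p (y i) * poly p (y (Suc i)) < 0"
  shows "hyperbolic p"
proof -
  have "\<exists>x. y i < x \<and> x < y (Suc i) \<and> poly p x = 0" if "i < d" for i
    using poly_IVT[OF y[OF that] alt[OF that]] by blast
  then obtain x where x: "\<And>i. i < d \<Longrightarrow> y i < x i \<and> x i < y (Suc i) \<and> poly p (x i) = 0"
    by metis
  have mono: "y i \<le> y j" if "i \<le> j" "j \<le> d" for i j
    using that(1,2)
  proof (induction j rule: dec_induct)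
    case (step n)
    then show ?case using y[of n] by simp
  qed simp
  have "x i < x j" if "i < j" "j < d" for i j
    using x[of i] x[of j] mono[of "Suc i" j] that by force
  then have inj: "inj_on x {..<d}"
    by (metis (mono_tags, lifting) inj_onI lessThan_iff less_irrefl linorder_neqE_nat)
  define q where "q = map_poly complex_of_real p"
  have "p \<noteq> 0" using alt[OF d] by auto
  then have q: "q \<noteq> 0" by (auto simp: q_def map_poly_eq_0_iff)
  have sub: "of_real ` x ` {..<d} \<subseteq> {z. poly q z = 0}"
    using x by (auto simp: q_def poly_map_poly_of_real)
  have "card {z. poly q z = 0} \<le> degree q" by (rule card_poly_roots_bound[OF q])
  also have "\<dots> \<le> d" using deg by (simp add: q_def degree_map_poly)
  also have "d = card (complex_of_real ` x ` {..<d})"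
    using inj by (simp add: card_image inj_on_def)
  finally have "of_real ` x ` {..<d} = {z. poly q z = 0}"
    using sub by (metis card_seteq poly_roots_finite q)
  then have "z \<in> of_real ` x ` {..<d}" if "poly q z = 0" for z
    using that by blast
  then show ?thesis unfolding hyperbolic_def q_def[symmetric] by (metis Reals_of_real imageE)
qed

section \<open>Hermite polynomials as Gaussian integrals\<close>

text \<open>Joins the even and odd moments into one sequence, characterised by the recursion that
  integration by parts would give.\<close>

lemma has_bochner_integral_std_normal_moment:
  obtains M :: "nat \<Rightarrow> real" where "M 0 = 1" "M 1 = 0" "\<And>k. M (Suc (Suc k)) = (k + 1) * M k"
    "\<And>k. has_bochner_integral lborel (\<lambda>u. std_normal_density u * u ^ k) (M k)"
proof -
  define M where "M = (\<lambda>k::nat. if even k then fact k / (2 ^ (k div 2) * fact (k div 2)) else (0::real))"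
  show ?thesis
  proof (rule that)
    show "M 0 = 1" "M 1 = 0" by (auto simp: M_def)
    show "M (Suc (Suc k)) = (k + 1) * M k" for k
    proof (cases "even k")
      case True
      then obtain j where j: "k = 2 * j" by (elim evenE)
      have "fact (2 * j + 2) = (2 * real j + 2) * (2 * real j + 1) * fact (2 * j)"
        by (simp add: fact_reduce algebra_simps)
      moreover have "fact (Suc j) = (real j + 1) * fact j" by simp
      ultimately show ?thesis by (simp add: M_def j divide_simps del: fact_Suc)
    qed (simp add: M_def)
    show "has_bochner_integral lborel (\<lambda>u. std_normal_density u * u ^ k) (M k)" for k
    proof (cases "even k")
      case True
      then obtain j where "k = 2 * j" by (elim evenE)
      then show ?thesis using std_normal_moment_even[of j] by (simp add: M_def)
    next
      case False
      then obtain j where "k = 2 * j + 1" by (elim oddE)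
      then show ?thesis using std_normal_moment_odd[of j] by (simp add: M_def)
    qed
  qed
qed

lemma has_bochner_integral_std_normal_mult_power:
  assumes M: "has_bochner_integral lborel (\<lambda>u. std_normal_density u * u ^ k) m"
  shows "has_bochner_integral lborel (\<lambda>u. of_real (std_normal_density u) * (c * of_real u ^ k)) (c * of_real m :: complex)"
proof -
  have "has_bochner_integral lborel (\<lambda>u. c * complex_of_real (std_normal_density u * u ^ k)) (c * of_real m)"
    by (intro has_bochner_integral_mult_right has_bochner_integral_of_real M)
  then show ?thesis by (simp add: mult_ac)
qed

text \<open>Stein's identity E[U p(U)] = E[p'(U)], as \<open>pCons 0 p\<close> is p times its
  variable. By linearity it reduces to the moment recursion.\<close>

lemma std_normal_integral_poly_by_parts:
  fixes p :: "complex poly"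
  defines "E \<equiv> \<lambda>p. \<integral>u. of_real (std_normal_density u) * poly p (of_real u) \<partial>lborel"
  shows "E (pCons 0 p) = E (pderiv p)"
proof -
  obtain M :: "nat \<Rightarrow> real" where M: "M 0 = 1" "M 1 = 0" "\<And>k. M (Suc (Suc k)) = (k + 1) * M k"
    "\<And>k. has_bochner_integral lborel (\<lambda>u. std_normal_density u * u ^ k) (M k)"
    using has_bochner_integral_std_normal_moment by blast
  have E: "E q = (\<Sum>k\<le>n. coeff q k * of_real (M k))" if "degree q \<le> n" for q n
  proof -
    have "has_bochner_integral lborel
        (\<lambda>u. \<Sum>k\<le>n. of_real (std_normal_density u) * (coeff q k * of_real u ^ k))
        (\<Sum>k\<le>n. coeff q k * of_real (M k))"
      by (intro has_bochner_integral_sum has_bochner_integral_std_normal_mult_power M)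
    moreover have "poly q x = (\<Sum>k\<le>n. coeff q k * x ^ k)" for x
      unfolding poly_altdef using that
      by (intro sum.mono_neutral_left) (auto simp: coeff_eq_0)
    ultimately show ?thesis
      by (simp add: E_def sum_distrib_left has_bochner_integral_integral_eq)
  qed
  define n where "n = degree p"
  have "E (pCons 0 p) = (\<Sum>k\<le>Suc (Suc n). coeff (pCons 0 p) k * of_real (M k))"
    by (rule E) (auto simp: n_def degree_pCons_eq_if)
  \<comment> \<open>The term \<open>k = 0\<close> vanishes because the constant coefficient is 0,
    the term \<open>k = 1\<close> because \<open>M 1 = 0\<close>.\<close>
  also have "\<dots> = (\<Sum>k\<le>n. coeff p (Suc k) * of_real (M (Suc (Suc k))))"
    using M(2) by (simp add: sum.atMost_Suc_shift del: sum.atMost_Suc)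
  also have "\<dots> = (\<Sum>k\<le>n. coeff (pderiv p) k * of_real (M k))"
    by (intro sum.cong) (auto simp: M(3) coeff_pderiv mult_ac)
  also have "\<dots> = E (pderiv p)"
    by (rule E[symmetric]) (auto simp: n_def degree_pderiv)
  finally show ?thesis .
qed

lemma integrable_std_normal_poly:
  "integrable lborel (\<lambda>u. of_real (std_normal_density u) * poly p (of_real u) :: complex)"
  unfolding poly_altdef sum_distrib_left
  by (intro Bochner_Integration.integrable_sum integrable.intros[OF
        has_bochner_integral_std_normal_mult_power[OF
          has_bochner_integral_integrable[OF integrable_std_normal_moment]]])

text \<open>Splitting one factor y + iU off the power and applying Stein's identity to the part with
  U gives the three-term Hermite recursion; its minus sign is the square of the imaginary
  unit.\<close>

lemma std_normal_integral_hermite: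
  "(\<integral>u. of_real (std_normal_density u) * (of_real y + \<i> * of_real u) ^ d \<partial>lborel)
     = complex_of_real (poly (hermite d) y)"
proof -
  define E where "E \<equiv> \<lambda>p. \<integral>u. of_real (std_normal_density u) * poly p (of_real u :: complex) \<partial>lborel"
  define l :: "complex poly" where "l = [:of_real y, \<i>:]"
  have E_smult: "E (smult c p) = c * E p" for c p
    by (simp add: E_def mult.left_commute[of _ c])
  have E_add: "E (p + q) = E p + E q" for p q
    by (simp add: E_def distrib_left integrable_std_normal_poly)
  have E0: "E 1 = 1"
  proof -
    have "E 1 = of_real (\<integral>u. std_normal_density u \<partial>lborel)"
      by (simp add: E_def)
    also have "\<dots> = 1" by simp
    finally show ?thesis .
  qed
  have E_Suc: "E (l ^ Suc d) = of_real y * E (l ^ d) + \<i> * E (pderiv (l ^ d))" for d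
  proof -
    have "l ^ Suc d = smult (of_real y) (l ^ d) + smult \<i> (pCons 0 (l ^ d))"
      by (simp add: l_def)
    then have "E (l ^ Suc d) = of_real y * E (l ^ d) + \<i> * E (pCons 0 (l ^ d))"
      by (simp only: E_add E_smult)
    then show ?thesis
      using std_normal_integral_poly_by_parts[of "l ^ d"] by (simp add: E_def)
  qed
  have "E (l ^ d) = of_real (poly (hermite d) y)"
  proof (induction d rule: induct_nat_012)
    case 0
    show ?case by (simp add: E0)
  next
    case 1
    show ?case using E_Suc[of 0] by (simp add: E0 E_def)
  next
    case (ge2 n)
    have "pderiv (l ^ Suc n) = smult (of_nat (Suc n) * \<i>) (l ^ n)"
      unfolding pderiv_power_Suc by (simp add: l_def pderiv_pCons mult.commute)
    then have "E (l ^ Suc (Suc n)) = of_real y * E (l ^ Suc n) - of_nat (Suc n) * E (l ^ n)"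
      using E_Suc[of "Suc n"] by (simp only: E_smult) (simp add: algebra_simps)
    then show ?case
      unfolding hermite_Suc_Suc ge2 by (simp del: hermite.simps)
  qed
  then show ?thesis by (simp add: E_def l_def mult.commute)
qed

section \<open>The logarithm of the generating function\<close>

text \<open>The coefficients of \<open>ln (1 + x\<^sup>2) - 2 ln (1 - x)\<close>. Their divisor sums are the Taylor coefficients
  of the logarithm of the generating function, because
  \<open>cubic_gf q = (\<Prod>j\<ge>1. (1 + q\<^bsup>2j\<^esup>) / (1 - q\<^bsup>j\<^esup>)\<^sup>2)\<close>.\<close>
definition log_weight :: "nat \<Rightarrow> real" where
  "log_weight m = 2 / m - (if even m then 2 * (-1) ^ (m div 2) / m else 0)"

definition cubic_log_coeff :: "nat \<Rightarrow> real" where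
  "cubic_log_coeff N = (\<Sum>m | m dvd N. log_weight m)"

lemma log_weight_0 [simp]: "log_weight 0 = 0"
  and log_weight_1 [simp]: "log_weight (Suc 0) = 2"
  by (simp_all add: log_weight_def)

text \<open>The weight is 2 / m for odd m, 4 / m for m congruent to 2 mod 4, and 0 when 4 divides m.
  At \<open>m = 0\<close> division by zero gives 0.\<close>

lemma log_weight_bounds: "0 \<le> log_weight m" "log_weight m \<le> 4 / m"
  by (auto simp: log_weight_def minus_one_power_iff intro: divide_right_mono)

lemma log_weight_sums:
  assumes "\<bar>x\<bar> < 1"
  shows "(\<lambda>m. log_weight m * x ^ m) sums (ln (1 + x\<^sup>2) - 2 * ln (1 - x))"
proof -
  have 1: "(\<lambda>n. - (x ^ n) / n) sums ln (1 - x)"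
    using ln_series'[of "- x"] assms by simp
  have "(\<lambda>k. - ((- (x\<^sup>2)) ^ k) / k) sums ln (1 + x\<^sup>2)"
    using ln_series'[of "x\<^sup>2"] assms by (simp add: abs_square_less_1)
  also have "(\<lambda>k. - ((- (x\<^sup>2)) ^ k) / real k) =
      (\<lambda>k. (\<lambda>m. - (if even m then 2 * (-1) ^ (m div 2) / m else 0) * x ^ m) (2 * k))"
    by (auto simp: fun_eq_iff power_minus[of "x\<^sup>2"] power_mult divide_simps)
  \<comment> \<open>The series in x^2 is spread over the even exponents; the odd ones carry
    coefficient 0.\<close>
  finally have 2: "(\<lambda>m. - (if even m then 2 * (-1) ^ (m div 2) / m else 0) * x ^ m) sums ln (1 + x\<^sup>2)"
    by (subst (asm) sums_mono_reindex) (auto simp: strict_mono_def elim!: evenE)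
  show ?thesis
    using sums_diff[OF 2 sums_mult[OF 1, of 2]]
    by (simp add: log_weight_def algebra_simps)
qed

lemma cubic_log_coeff_0 [simp]: "cubic_log_coeff 0 = 0"
  by (simp add: cubic_log_coeff_def)

lemma cubic_log_coeff_nonneg: "cubic_log_coeff N \<ge> 0"
  by (simp add: cubic_log_coeff_def sum_nonneg log_weight_bounds)

text \<open>The divisor 1 alone has weight 2. Every later lower bound, for the saddle point and for
  the decay along the circle, comes from this one.\<close>

lemma cubic_log_coeff_ge_2:
  assumes "N > 0"
  shows "cubic_log_coeff N \<ge> 2"
proof -
  have "(\<Sum>m\<in>{1}. log_weight m) \<le> cubic_log_coeff N"
    unfolding cubic_log_coeff_def using assms
    by (intro sum_mono2) (auto simp: log_weight_bounds)
  then show ?thesis by simp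
qed

section \<open>From the infinite product to the exponential of a power series\<close>

lemma qpoch_inf_eq_exp:
  assumes "\<bar>a\<bar> < 1" "\<bar>q\<bar> < 1"
  shows "summable (\<lambda>j. ln (1 - a * q ^ j))"
    and "qpoch_inf a q = exp (\<Sum>j. ln (1 - a * q ^ j))"
proof -
  have "\<bar>a * q ^ j\<bar> < 1" for j
  proof -
    have "\<bar>q\<bar> ^ j \<le> 1" using assms by (simp add: power_le_one)
    then have "\<bar>a\<bar> * \<bar>q\<bar> ^ j \<le> \<bar>a\<bar>" by (simp add: mult_left_le)
    then show ?thesis using assms by (simp add: abs_mult power_abs)
  qed
  then have pos: "1 - a * q ^ j > 0" for j by (smt (verit))
  have "summable (\<lambda>j. \<bar>a\<bar> * \<bar>q\<bar> ^ j)"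
    using assms by (intro summable_mult summable_geometric) simp
  then have "abs_convergent_prod (\<lambda>j. 1 - a * q ^ j)"
    by (simp add: abs_convergent_prod_conv_summable abs_mult power_abs)
  then have "convergent_prod (\<lambda>j. 1 - a * q ^ j)" by (rule abs_convergent_prod_imp_convergent_prod)
  then show "summable (\<lambda>j. ln (1 - a * q ^ j))" "qpoch_inf a q = exp (\<Sum>j. ln (1 - a * q ^ j))"
    using pos by (simp_all add: summable_ln_real qpoch_inf_def prodinf_exp_real)
qed

lemma cubic_gf_eq_exp:
  assumes q: "\<bar>q\<bar> < 1"
    and S: "(\<lambda>j. ln (1 + (q ^ Suc j)\<^sup>2) - 2 * ln (1 - q ^ Suc j)) sums S"
  shows "cubic_gf q = exp S"
proof -
  have q2: "\<bar>q\<^sup>2\<bar> < 1" using q by (simp add: abs_square_less_1)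
  note s = qpoch_inf_eq_exp(1)[THEN summable_sums, of "-q" q] qpoch_inf_eq_exp(1)[THEN summable_sums, of "-(q\<^sup>2)" "q\<^sup>2"]
    qpoch_inf_eq_exp(1)[THEN summable_sums, of q q] qpoch_inf_eq_exp(1)[THEN summable_sums, of "q\<^sup>2" "q\<^sup>2"]
  have "(\<lambda>j. ln (1 - (-q) * q ^ j) + ln (1 - (-(q\<^sup>2)) * (q\<^sup>2) ^ j)
          - (ln (1 - q * q ^ j) + ln (1 - q\<^sup>2 * (q\<^sup>2) ^ j))) sums
        ((\<Sum>j. ln (1 - (-q) * q ^ j)) + (\<Sum>j. ln (1 - (-(q\<^sup>2)) * (q\<^sup>2) ^ j))
          - ((\<Sum>j. ln (1 - q * q ^ j)) + (\<Sum>j. ln (1 - q\<^sup>2 * (q\<^sup>2) ^ j))))"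
    by (intro sums_add sums_diff s) (use q q2 in auto)
  also have "(\<lambda>j. ln (1 - (-q) * q ^ j) + ln (1 - (-(q\<^sup>2)) * (q\<^sup>2) ^ j)
          - (ln (1 - q * q ^ j) + ln (1 - q\<^sup>2 * (q\<^sup>2) ^ j)))
        = (\<lambda>j. ln (1 + (q ^ Suc j)\<^sup>2) - 2 * ln (1 - q ^ Suc j))"
  proof
    fix j
    define x where "x = q ^ Suc j"
    have x: "\<bar>x\<bar> < 1" using q by (simp add: x_def power_abs power_less_one_iff del: power_Suc)
    \<comment> \<open>This cancels the factor 1 + x of the numerator and leaves (1 + x^2) / (1 -
      x)^2.\<close>
    have "1 - x\<^sup>2 = (1 - x) * (1 + x)" by (simp add: algebra_simps power2_eq_square)
    moreover have "1 - x > 0" "1 + x > 0" using x by auto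
    ultimately have "ln (1 - x\<^sup>2) = ln (1 - x) + ln (1 + x)" by (simp add: ln_mult_pos)
    moreover have "q * q ^ j = x" "q\<^sup>2 * (q\<^sup>2) ^ j = x\<^sup>2"
      by (simp_all add: x_def power_mult_distrib power2_eq_square)
    ultimately show "ln (1 - (-q) * q ^ j) + ln (1 - (-(q\<^sup>2)) * (q\<^sup>2) ^ j)
          - (ln (1 - q * q ^ j) + ln (1 - q\<^sup>2 * (q\<^sup>2) ^ j)) = ln (1 + (q ^ Suc j)\<^sup>2) - 2 * ln (1 - q ^ Suc j)"
      unfolding x_def[symmetric] by simp
  qed
  finally have "S = (\<Sum>j. ln (1 - (-q) * q ^ j)) + (\<Sum>j. ln (1 - (-(q\<^sup>2)) * (q\<^sup>2) ^ j))
          - ((\<Sum>j. ln (1 - q * q ^ j)) + (\<Sum>j. ln (1 - q\<^sup>2 * (q\<^sup>2) ^ j)))"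
    using S sums_unique2 by blast
  then show ?thesis
    using q q2 by (simp only: cubic_gf_def qpoch_inf_eq_exp(2) abs_minus_cancel exp_diff exp_add)
qed

text \<open>One absolutely summable double family is summed in two ways: by rows it gives the
  logarithms of the factors of the product, by the value of the exponent it gives the divisor
  sums.\<close>

lemma cubic_log_coeff_sums:
  assumes q: "\<bar>q\<bar> < 1"
  obtains S where "(\<lambda>N. cubic_log_coeff N * q ^ N) sums S"
    "(\<lambda>j. ln (1 + (q ^ Suc j)\<^sup>2) - 2 * ln (1 - q ^ Suc j)) sums S"
proof -
  define h where "h = (\<lambda>(j, m). log_weight (Suc m) * q ^ (Suc j * Suc m))"
  have "(\<lambda>n. \<bar>q\<bar> ^ n) summable_on UNIV"
    using q by (intro norm_summable_imp_summable_on) (simp add: summable_geometric)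
  \<comment> \<open>The majorant comes from \<open>log_weight (Suc m) \<le> 4\<close> and (j + 1)(m
    + 1) \<ge> j + m.\<close>
  then have "(\<lambda>jm. norm ((\<lambda>(j, m). \<bar>q\<bar> ^ j * (4 * \<bar>q\<bar> ^ m)) jm)) summable_on (UNIV :: nat set) \<times> (UNIV :: nat set)"
    by (subst Infinite_Sum.abs_summable_on_Sigma_iff)
      (auto simp: abs_mult infsum_cmult_right' intro!: summable_on_cmult_right summable_on_cmult_left)
  then have "(\<lambda>jm. norm (h jm)) summable_on UNIV \<times> UNIV"
  proof (rule Infinite_Sum.abs_summable_on_comparison_test)
    fix x :: "nat \<times> nat"
    obtain j m where x: "x = (j, m)" by (cases x)
    have "log_weight (Suc m) \<le> 4"
      using log_weight_bounds(2)[of "Suc m"] by (rule order_trans) (simp add: divide_simps)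
    moreover have "\<bar>q\<bar> ^ (Suc j * Suc m) \<le> \<bar>q\<bar> ^ (j + m)"
      using q by (intro power_decreasing) auto
    ultimately have "log_weight (Suc m) * \<bar>q\<bar> ^ (Suc j * Suc m) \<le> 4 * \<bar>q\<bar> ^ (j + m)"
      by (intro mult_mono) auto
    then show "norm (h x) \<le> norm ((\<lambda>(j, m). \<bar>q\<bar> ^ j * (4 * \<bar>q\<bar> ^ m)) x)"
      using log_weight_bounds(1)[of "Suc m"]
      by (simp add: x h_def abs_mult power_abs power_add mult_ac)
  qed
  then obtain S where S: "(h has_sum S) (UNIV \<times> UNIV)"
    using abs_summable_summable[of h] summable_iff_has_sum_infsum by blast
  have "((\<lambda>j. ln (1 + (q ^ Suc j)\<^sup>2) - 2 * ln (1 - q ^ Suc j)) has_sum S) UNIV"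
  proof (rule has_sum_SigmaD[OF S])
    fix j :: nat
    define x where "x = q ^ Suc j"
    have x: "\<bar>x\<bar> < 1" using q by (simp add: x_def power_abs power_less_one_iff del: power_Suc)
    have "(\<lambda>m. log_weight m * x ^ m) sums (ln (1 + x\<^sup>2) - 2 * ln (1 - x))"
      by (rule log_weight_sums[OF x])
    then have "(\<lambda>m. log_weight (Suc m) * x ^ Suc m) sums (ln (1 + x\<^sup>2) - 2 * ln (1 - x))"
      by (subst sums_Suc_iff) simp
    moreover have "summable (\<lambda>m. log_weight (Suc m) * \<bar>x\<bar> ^ Suc m)"
      using log_weight_sums[of "\<bar>x\<bar>"] x
      by (subst summable_Suc_iff) (auto simp: sums_iff)
    then have "summable (\<lambda>m. norm (log_weight (Suc m) * x ^ Suc m))"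
      by (simp add: abs_mult power_abs log_weight_bounds del: power_Suc)
    ultimately have "((\<lambda>m. log_weight (Suc m) * x ^ Suc m) has_sum (ln (1 + x\<^sup>2) - 2 * ln (1 - x))) UNIV"
      by (intro norm_summable_imp_has_sum)
    then show "((\<lambda>m. h (j, m)) has_sum (ln (1 + (q ^ Suc j)\<^sup>2) - 2 * ln (1 - q ^ Suc j))) UNIV"
      by (simp add: h_def x_def power_mult del: power_Suc mult_Suc mult_Suc_right)
  qed
  \<comment> \<open>Pairs (j, m) correspond to a positive N with a chosen divisor, both factors
    being shifted by 1. N = 0 is left out because every number divides it; there
    \<open>cubic_log_coeff\<close> is 0, as a sum over an infinite set.\<close>
  moreover have "((\<lambda>(N, m). log_weight m * q ^ N) has_sum S) (Sigma {0<..} (\<lambda>N. {m. m dvd N}))"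
  proof (subst has_sum_reindex_bij_witness[where
        i = "\<lambda>(j, m). (Suc j * Suc m, Suc m)" and j = "\<lambda>(N, m). (N div m - 1, m - 1)"
        and T = "UNIV \<times> UNIV" and h = h and s' = S])
    show "(h has_sum S) (UNIV \<times> UNIV)" by (rule S)
  next
    fix a :: "nat \<times> nat" assume "a \<in> Sigma {0<..} (\<lambda>N. {m. m dvd N})"
    then obtain N m where Nm: "a = (N, m)" "N > 0" "m dvd N" by auto
    then obtain k where k: "N = m * k" by (elim dvdE)
    obtain m' k' where "m = Suc m'" "k = Suc k'"
      using Nm(2) k by (cases m; cases k) auto
    with Nm k have *: "a = (Suc k' * Suc m', Suc m')" by (simp add: mult.commute del: mult_Suc mult_Suc_right)
    show "(\<lambda>(j, m). (Suc j * Suc m, Suc m)) ((\<lambda>(N, m). (N div m - 1, m - 1)) a) = a"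
      and "h ((\<lambda>(N, m). (N div m - 1, m - 1)) a) = (\<lambda>(N, m). log_weight m * q ^ N) a"
      unfolding * by (simp_all add: h_def del: mult_Suc mult_Suc_right)
  qed (auto simp del: mult_Suc mult_Suc_right)
  then have "((\<lambda>N. cubic_log_coeff N * q ^ N) has_sum S) {0<..}"
    by (rule has_sum_SigmaD)
      (auto intro!: has_sum_finiteI simp: cubic_log_coeff_def sum_distrib_right)
  then have "((\<lambda>N. cubic_log_coeff N * q ^ N) has_sum S) UNIV"
    by (rule has_sum_cong_neutral[THEN iffD1, rotated -1]) auto
  ultimately show ?thesis by (intro that has_sum_imp_sums)
qed

text \<open>Once the lower coefficients vanish, divide by \<open>x ^ n\<close> and let x tend to 0.
  This uniqueness is what gives the definite description of \<open>cubic_overpartition\<close> a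
  meaning.\<close>

lemma powser_coeffs_eq_0:
  fixes d :: "nat \<Rightarrow> real"
  assumes "\<And>x. \<bar>x\<bar> < 1 \<Longrightarrow> (\<lambda>n. d n * x ^ n) sums 0"
  shows "d n = 0"
proof (induction n rule: less_induct)
  case (less n)
  have "(\<lambda>k. d (k + n) * x ^ k) sums 0" if x: "x \<noteq> 0" "norm x < 1" for x
  proof -
    have "(\<lambda>k. d (k + n) * x ^ (k + n)) sums 0"
      using assms[of x] x less by (subst sums_iff_shift) simp
    then have "(\<lambda>k. d (k + n) * x ^ (k + n) / x ^ n) sums (0 / x ^ n)"
      by (rule sums_divide)
    then show ?thesis using x by (simp add: power_add)
  qed
  then have "((\<lambda>_. 0) \<longlongrightarrow> d (0 + n)) (at (0::real))"
    by (intro powser_limit_0_strong[of 1 "\<lambda>k. d (k + n)"]) auto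
  then show ?case using LIM_const_eq by fastforce
qed

lemma summable_cubic_log_coeff:
  fixes z :: "'a :: {real_normed_field, banach}"
  assumes "norm z < 1"
  shows "summable (\<lambda>N. of_real (cubic_log_coeff N) * z ^ N)"
proof (rule summable_norm_cancel)
  obtain S where "(\<lambda>N. cubic_log_coeff N * norm z ^ N) sums S"
    by (rule cubic_log_coeff_sums[of "norm z"]) (use assms in auto)
  then show "summable (\<lambda>N. norm (of_real (cubic_log_coeff N) * z ^ N))"
    by (simp add: norm_mult norm_power cubic_log_coeff_nonneg sums_iff)
qed

lemma cubic_gf_eq_exp_suminf:
  assumes "\<bar>q\<bar> < 1"
  shows "cubic_gf q = exp (\<Sum>N. cubic_log_coeff N * q ^ N)"
  by (rule cubic_log_coeff_sums[OF assms]) (simp add: cubic_gf_eq_exp[OF assms] sums_iff)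

text \<open>The exponential is holomorphic in the unit disc, so it has Taylor coefficients there. On
  the real axis it equals \<open>cubic_gf\<close>; uniqueness of real power series then shows that
  these coefficients are real and that they are the sequence in question.\<close>

theorem cubic_overpartition_sums:
  assumes "norm z < 1"
  shows "(\<lambda>n. complex_of_real (cubic_overpartition n) * z ^ n) sums
           exp (\<Sum>N. of_real (cubic_log_coeff N) * z ^ N)"
proof -
  define f where "f = (\<lambda>z::complex. exp (\<Sum>N. of_real (cubic_log_coeff N) * z ^ N))"
  define b where "b = (\<lambda>n. (deriv ^^ n) f 0 / fact n)"
  have "(\<lambda>z::complex. \<Sum>N. of_real (cubic_log_coeff N) * z ^ N) field_differentiable at z" if "norm z < 1" for z
  proof -
    obtain r where r: "norm z < r" "r < 1" using dense[OF \<open>norm z < 1\<close>] by blast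
    then have r0: "r > 0" using norm_ge_zero[of z] by linarith
    have "summable (\<lambda>N. of_real (cubic_log_coeff N) * complex_of_real r ^ N)"
      using r r0 by (intro summable_cubic_log_coeff) simp
    from termdiffs_strong[OF this, of z] show ?thesis
      using r r0 by (auto simp: field_differentiable_def)
  qed
  then have "(\<lambda>z::complex. \<Sum>N. of_real (cubic_log_coeff N) * z ^ N) holomorphic_on ball 0 1"
    by (auto simp: holomorphic_on_def field_differentiable_at_within)
  then have "f holomorphic_on ball 0 1"
    unfolding f_def by (rule holomorphic_on_exp')
  from holomorphic_power_series[OF this] have b: "(\<lambda>n. b n * z ^ n) sums f z" if "norm z < 1" for z
    using that by (simp add: b_def)
  have f_real: "f (of_real q) = of_real (cubic_gf q)" if "\<bar>q\<bar> < 1" for q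
  proof -
    have "(\<Sum>N. complex_of_real (cubic_log_coeff N * q ^ N)) = of_real (\<Sum>N. cubic_log_coeff N * q ^ N)"
      using summable_cubic_log_coeff[of q] that by (intro suminf_of_real[symmetric]) simp
    then show ?thesis
      using that by (simp add: f_def cubic_gf_eq_exp_suminf exp_of_real)
  qed
  have b_real: "(\<lambda>n. b n * of_real (q ^ n)) sums of_real (cubic_gf q)" if "\<bar>q\<bar> < 1" for q
    using b[of "of_real q"] that by (simp add: f_real)
  have "Im (b n) = 0" for n
  proof (rule powser_coeffs_eq_0)
    fix x :: real
    assume "\<bar>x\<bar> < 1"
    from sums_Im[OF b_real[OF this]] show "(\<lambda>n. Im (b n) * x ^ n) sums 0"
      by simp
  qed
  then have b_Re: "b n = of_real (Re (b n))" for n by (simp add: complex_eq_iff)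
  have Re_b: "(\<lambda>n. Re (b n) * q ^ n) sums cubic_gf q" if "\<bar>q\<bar> < 1" for q
    using sums_Re[OF b_real[OF that]] by simp
  have "cubic_overpartition = (\<lambda>n. Re (b n))"
    unfolding cubic_overpartition_def
  proof (rule the_equality)
    show "\<forall>q. \<bar>q\<bar> < 1 \<longrightarrow> (\<lambda>n. Re (b n) * q ^ n) sums cubic_gf q" using Re_b by blast
    fix a
    assume a: "\<forall>q. \<bar>q\<bar> < 1 \<longrightarrow> (\<lambda>n. a n * q ^ n) sums cubic_gf q"
    have "a n - Re (b n) = 0" for n
    proof (rule powser_coeffs_eq_0)
      fix q :: real
      assume q: "\<bar>q\<bar> < 1"
      show "(\<lambda>n. (a n - Re (b n)) * q ^ n) sums 0"
        using sums_diff[OF a[rule_format, OF q] Re_b[OF q]] by (simp add: left_diff_distrib)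
    qed
    then show "a = (\<lambda>n. Re (b n))" by auto
  qed
  then have "complex_of_real (cubic_overpartition n) = b n" for n
    using b_Re[of n] by metis
  then show ?thesis using b[OF assms] by (simp add: f_def)
qed

section \<open>Moments of the logarithmic coefficients\<close>

lemma power_le_fact_mult_exp:
  assumes "x \<ge> (0::real)"
  shows "x ^ p \<le> fact p * exp x"
proof -
  have "(\<Sum>n\<in>{p}. inverse (fact n) * x ^ n) \<le> (\<Sum>n. inverse (fact n) * x ^ n)"
    using summable_exp[of x] assms by (intro sum_le_suminf) auto
  then show ?thesis by (simp add: exp_def field_simps)
qed

lemma sum_exp_le_inverse:
  assumes "y > (0::real)"
  shows "(\<Sum>j=1..n. exp (- (y * real j))) \<le> 1 / y"
proof -
  have "(\<Sum>j=1..n. exp (- (y * real j))) * y \<le> 1 - exp (- (y * n))"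
  proof (induction n)
    case (Suc n)
    have "exp (- (y * Suc n)) * y \<le> exp (- (y * Suc n)) * (exp y - 1)"
      using exp_ge_add_one_self[of y] by (intro mult_left_mono) (simp_all only: le_diff_eq add.commute exp_ge_zero)
    also have "\<dots> = exp (- (y * n)) - exp (- (y * Suc n))"
      by (simp add: algebra_simps flip: exp_add)
    finally show ?case using Suc by (simp add: distrib_right)
  qed simp
  also have "\<dots> \<le> 1" by simp
  finally show ?thesis using assms by (simp add: pos_le_divide_eq)
qed

lemma sum_inverse_squares_le_2: "(\<Sum>m=1..n. 1 / (real m)\<^sup>2) \<le> 2"
proof -
  have "(\<Sum>m=1..n. 1 / (real m)\<^sup>2) \<le> 2 - 1 / n"
  proof (induction n)
    case (Suc n)
    show ?case
    proof (cases "n = 0")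
      case False
      then have "1 / (real (Suc n))\<^sup>2 \<le> 1 / n - 1 / Suc n"
        by (simp add: divide_simps power2_eq_square)
      then show ?thesis using Suc by simp
    qed simp
  qed simp
  also have "\<dots> \<le> 2" by simp
  finally show ?thesis .
qed

text \<open>Up to the sign (-1)^p, the p-th derivative in \<tau> of the logarithm of the generating
  function at \<open>exp (- \<tau>)\<close>: p = 1 enters the saddle point equation and p = 2 is
  V.\<close>

definition log_moment :: "nat \<Rightarrow> real \<Rightarrow> real" where
  "log_moment p \<tau> = (\<Sum>N. cubic_log_coeff N * real N ^ p * exp (- (\<tau> * N)))"

text \<open>\<open>fact p * 2 ^ p\<close> is the price of absorbing the power into half of the
  exponential; the remaining 16 is 4 from \<open>log_weight_bounds\<close>, 2 from the halved decay
  rate and 2 from the sum of inverse squares.\<close>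

definition moment_const :: "nat \<Rightarrow> real" where
  "moment_const p = 8 * fact p * 2 ^ Suc p"

lemma moment_const_pos: "moment_const p > 0"
  by (simp add: moment_const_def)

text \<open>Writing N = m j turns the divisor sums into a sum over pairs, which nonnegativity allows
  to extend to a full square. The sum over j is geometric, of order 1 / (\<tau> m), and with the
  weight of order 1 / m the sum over m converges.\<close>

lemma log_moment_partial_sum_le:
  assumes \<tau>: "\<tau> > 0"
  shows "(\<Sum>N<M. cubic_log_coeff N * real N ^ p * exp (- (\<tau> * N))) \<le> moment_const p / \<tau> ^ Suc p"
proof -
  define f where "f = (\<lambda>N::nat. real N ^ p * exp (- (\<tau> * N)))"
  define B where "B = fact p * (2 / \<tau>) ^ p"
  have B: "B \<ge> 0" using \<tau> by (simp add: B_def)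
  \<comment> \<open>Half of the exponential pays for the power of N, the other half is kept for the
    geometric sum.\<close>
  have f: "f N \<le> B * exp (- (\<tau> * N / 2))" for N
  proof -
    have "(\<tau> * N / 2) ^ p \<le> fact p * exp (\<tau> * N / 2)"
      using \<tau> by (intro power_le_fact_mult_exp) simp
    then have "(2 / \<tau>) ^ p * (\<tau> * N / 2) ^ p \<le> (2 / \<tau>) ^ p * (fact p * exp (\<tau> * N / 2))"
      using \<tau> by (intro mult_left_mono) auto
    also have "(2 / \<tau>) ^ p * (\<tau> * N / 2) ^ p = real N ^ p"
      using \<tau> by (simp flip: power_mult_distrib)
    finally have "f N \<le> B * exp (\<tau> * N / 2) * exp (- (\<tau> * N))"
      unfolding f_def B_def by (simp add: mult_ac)
    also have "\<dots> = B * exp (- (\<tau> * N / 2))"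
      by (simp add: mult.assoc flip: exp_add)
    finally show ?thesis .
  qed
  have "(\<Sum>N<M. cubic_log_coeff N * real N ^ p * exp (- (\<tau> * N))) = (\<Sum>N\<in>{1..M} \<inter> {..<M}. cubic_log_coeff N * f N)"
    by (intro sum.mono_neutral_cong_right) (auto simp: f_def not_le)
  also have "\<dots> \<le> (\<Sum>N\<in>{1..M}. cubic_log_coeff N * f N)"
    by (intro sum_mono2) (auto simp: f_def cubic_log_coeff_nonneg)
  also have "\<dots> = (\<Sum>N\<in>{1..M}. \<Sum>m | m dvd N. log_weight m * f N)"
    by (simp add: cubic_log_coeff_def sum_distrib_right)
  also have "\<dots> = (\<Sum>(N, m)\<in>Sigma {1..M} (\<lambda>N. {m. m dvd N}). log_weight m * f N)"
    by (intro sum.Sigma) auto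
  also have "\<dots> = (\<Sum>(m, j)\<in>(\<lambda>(N, m). (m, N div m)) ` Sigma {1..M} (\<lambda>N. {m. m dvd N}). log_weight m * f (m * j))"
    by (subst sum.reindex) (auto simp: inj_on_def intro!: sum.cong elim!: dvdE)
  also have "\<dots> \<le> (\<Sum>(m, j)\<in>{1..M} \<times> {1..M}. log_weight m * f (m * j))"
  proof (rule sum_mono2)
    show "(\<lambda>(N, m). (m, N div m)) ` Sigma {1..M} (\<lambda>N. {m. m dvd N}) \<subseteq> {1..M} \<times> {1..M}"
    proof safe
      fix N m assume *: "N \<in> {1..M}" "m dvd N"
      then have "m \<le> N" "N div m \<le> N" "m > 0" using dvd_imp_le by auto
      moreover from this * have "N div m \<le> M" by (meson atLeastAtMost_iff order_trans)
      ultimately show "m \<in> {1..M}" "N div m \<in> {1..M}" using *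
        by (auto simp: Suc_le_eq div_greater_zero_iff)
    qed
  qed (auto simp: f_def log_weight_bounds)
  also have "\<dots> = (\<Sum>m=1..M. \<Sum>j=1..M. log_weight m * f (m * j))"
    by (rule sum.cartesian_product[symmetric])
  also have "\<dots> \<le> (\<Sum>m=1..M. 8 * B / \<tau> * (1 / (real m)\<^sup>2))"
  proof (rule sum_mono)
    fix m assume "m \<in> {1..M}"
    then have m: "m > 0" by auto
    have "(\<Sum>j=1..M. f (m * j)) \<le> (\<Sum>j=1..M. B * exp (- (\<tau> * m / 2 * j)))"
      using f[of "m * j" for j] by (intro sum_mono) (simp add: mult_ac)
    also have "\<dots> = B * (\<Sum>j=1..M. exp (- (\<tau> * m / 2 * j)))"
      by (simp add: sum_distrib_left)
    also have "\<dots> \<le> B * (1 / (\<tau> * m / 2))"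
      using \<tau> m B by (intro mult_left_mono sum_exp_le_inverse) auto
    finally have *: "(\<Sum>j=1..M. f (m * j)) \<le> B * (1 / (\<tau> * m / 2))" .
    have "(\<Sum>j=1..M. log_weight m * f (m * j)) = log_weight m * (\<Sum>j=1..M. f (m * j))"
      by (simp add: sum_distrib_left)
    also have "\<dots> \<le> 4 / m * (B * (1 / (\<tau> * m / 2)))"
      using * log_weight_bounds[of m] by (intro mult_mono) (auto simp: f_def intro!: sum_nonneg)
    also have "\<dots> = 8 * B / \<tau> * (1 / (real m)\<^sup>2)"
      by (simp add: power2_eq_square)
    finally show "(\<Sum>j=1..M. log_weight m * f (m * j)) \<le> 8 * B / \<tau> * (1 / (real m)\<^sup>2)" .
  qed
  also have "\<dots> = 8 * B / \<tau> * (\<Sum>m=1..M. 1 / (real m)\<^sup>2)"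
    by (simp add: sum_distrib_left)
  also have "\<dots> \<le> 8 * B / \<tau> * 2"
    using \<tau> B by (intro mult_left_mono sum_inverse_squares_le_2) auto
  also have "\<dots> = moment_const p / \<tau> ^ Suc p"
    by (simp add: B_def moment_const_def power_divide)
  finally show ?thesis .
qed

lemma summable_log_moment:
  fixes \<tau> :: real
  assumes "\<tau> > 0"
  shows "summable (\<lambda>N. cubic_log_coeff N * real N ^ p * exp (- (\<tau> * N)))"
  using log_moment_partial_sum_le[OF assms]
  by (intro summableI_nonneg_bounded) (auto simp: cubic_log_coeff_nonneg)

lemma log_moment_le:
  assumes "\<tau> > 0"
  shows "log_moment p \<tau> \<le> moment_const p / \<tau> ^ Suc p"
  unfolding log_moment_def
  by (intro suminf_le_const summable_log_moment log_moment_partial_sum_le assms)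

text \<open>Only the terms N \<le> M are kept: there the exponential is at least 1 / e and, for N >
  0, the coefficient is at least 2.\<close>

lemma log_moment_1_ge:
  fixes M :: nat
  assumes "M > 0"
  shows "log_moment 1 (1 / M) \<ge> M * (M + 1) / exp 1"
proof -
  have "M * (M + 1) / exp 1 = (\<Sum>N\<in>{..M}. 2 * real N * exp (-1))"
  proof -
    have "(\<Sum>N\<in>{..M}. 2 * real N * exp (-1)) = 2 * (\<Sum>N\<in>{0..M}. real N) * exp (-1)"
      by (simp add: sum_distrib_left sum_distrib_right atMost_atLeast0)
    also have "2 * (\<Sum>N\<in>{0..M}. real N) = M * (M + 1)"
      using double_gauss_sum[of M, where ?'a = real] by (simp add: algebra_simps)
    finally show ?thesis by (simp only: exp_minus divide_inverse)
  qed
  also have "\<dots> \<le> (\<Sum>N\<in>{..M}. cubic_log_coeff N * real N ^ 1 * exp (- (1 / M * N)))"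
  proof (rule sum_mono)
    fix N assume N: "N \<in> {..M}"
    show "2 * real N * exp (-1) \<le> cubic_log_coeff N * real N ^ 1 * exp (- (1 / M * N))"
    proof (cases "N = 0")
      case False
      with N assms cubic_log_coeff_ge_2[of N] show ?thesis
        by (intro mult_mono) (auto simp: divide_simps)
    qed simp
  qed
  also have "\<dots> \<le> log_moment 1 (1 / M)"
    unfolding log_moment_def using assms
    by (intro sum_le_suminf summable_log_moment) (auto simp: cubic_log_coeff_nonneg)
  finally show ?thesis .
qed

lemma isCont_log_moment:
  assumes "\<tau> > 0"
  shows "isCont (log_moment p) \<tau>"
proof -
  have pow: "log_moment p t = (\<Sum>N. (cubic_log_coeff N * real N ^ p) * exp (- t) ^ N)" for t
    unfolding log_moment_def by (simp add: mult.commute flip: exp_of_nat_mult)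
  \<comment> \<open>Convergence at a strictly larger radius gives continuity at
    \<open>exp (- \<tau>)\<close>.\<close>
  have "summable (\<lambda>N. (cubic_log_coeff N * real N ^ p) * exp (- (\<tau> / 2)) ^ N)"
    using summable_log_moment[of "\<tau> / 2" p] assms by (simp add: mult.commute flip: exp_of_nat_mult)
  then have "isCont (\<lambda>x. \<Sum>N. (cubic_log_coeff N * real N ^ p) * x ^ N) (exp (- \<tau>))"
    using assms by (intro isCont_powser) auto
  then have "isCont (\<lambda>t. (\<lambda>x. \<Sum>N. (cubic_log_coeff N * real N ^ p) * x ^ N) (exp (- t))) \<tau>"
    by (rule isCont_o2[rotated]) (intro continuous_intros)
  then show ?thesis unfolding pow[abs_def] .
qed

lemma saddle_point_exists:
  assumes n: "n > 0"
  obtains \<tau> where "\<tau> > 0" "log_moment 1 \<tau> = real n"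
proof -
  \<comment> \<open>The end points for the intermediate value theorem: the 3 in \<open>a\<close>
    makes up for e \<le> 3 in \<open>log_moment_1_ge\<close>, and \<open>b\<close> is so large that
    the upper bound \<open>moment_const 1 / b ^ 2\<close> is at most 1.\<close>
  define a where "a = 1 / real (3 * n)"
  define b where "b = max 1 (moment_const 1)"
  have ab: "0 < a" "a \<le> 1" "1 \<le> b" using n by (auto simp: a_def b_def divide_simps)
  have "n \<le> real (3 * n) * (real (3 * n) + 1) / 3"
    using n by (auto simp: divide_simps) 
  also have "\<dots> \<le> real (3 * n) * (real (3 * n) + 1) / exp 1"
    using exp_le by (intro divide_left_mono) auto
  also have "\<dots> \<le> log_moment 1 a"
    unfolding a_def using n log_moment_1_ge[of "3 * n"] by (simp add: algebra_simps)
  finally have "n \<le> log_moment 1 a" .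
  moreover have "log_moment 1 b \<le> n"
  proof -
    have "log_moment 1 b \<le> moment_const 1 / b ^ Suc 1"
      using ab by (intro log_moment_le) auto
    also have "\<dots> \<le> 1"
    proof -
      have "moment_const 1 * 1 \<le> b * b" 
        using moment_const_pos[of 1] by (intro mult_mono) (auto simp: b_def)
      then show ?thesis using ab by (simp add: divide_simps)
    qed
    also have "1 \<le> real n" using n by simp
    finally show ?thesis .
  qed
  ultimately obtain \<tau> where "a \<le> \<tau>" "\<tau> \<le> b" "log_moment 1 \<tau> = real n"
    using IVT2[of "log_moment 1" b "real n" a] ab isCont_log_moment by force
  with ab show ?thesis by (intro that[of \<tau>]) auto
qed

section \<open>Behaviour on the circle\<close>

lemma one_minus_cos_ge:
  assumes "\<bar>t\<bar> \<le> pi"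
  shows "1 - cos t \<ge> t\<^sup>2 / 18"
proof -
  \<comment> \<open>From |sin x - x| \<le> x^3 / 6 and x \<le> 2 one loses at most 2 x / 3. The
    constant 18 then arises from 2 (t / 6)^2.\<close>
  have *: "sin x \<ge> x / 3" if x: "0 \<le> x" "x \<le> pi / 2" for x
  proof -
    have "\<bar>Im (iexp x - (\<Sum>k\<le>2. (\<i> * x) ^ k / fact k))\<bar> \<le> \<bar>x\<bar> ^ Suc 2 / fact (Suc 2)"
      by (rule order_trans[OF abs_Im_le_cmod iexp_approx1])
    then have "\<bar>sin x - x\<bar> \<le> x ^ 3 / 6"
      using x by (simp add: numeral_2_eq_2 numeral_3_eq_3 Im_exp)
    moreover have "x ^ 3 \<le> 4 * x"
    proof -
      have "x \<le> 2" using x pi_half_less_two by simp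
      then have "x * (x * x) \<le> x * (2 * 2)" using x by (intro mult_left_mono mult_mono) auto
      then show ?thesis by (simp add: power3_eq_cube mult_ac)
    qed
    ultimately show ?thesis by linarith
  qed
  have "\<bar>t\<bar> / 6 \<le> sin (\<bar>t\<bar> / 2)" using *[of "\<bar>t\<bar> / 2"] assms by simp
  then have "(\<bar>t\<bar> / 6)\<^sup>2 \<le> (sin (\<bar>t\<bar> / 2))\<^sup>2" by (intro power_mono) auto
  moreover have "1 - cos t = 2 * (sin (\<bar>t\<bar> / 2))\<^sup>2"
    using cos_double_sin[of "\<bar>t\<bar> / 2"] by simp
  ultimately show ?thesis by (simp add: power_divide)
qed

text \<open>The value is the real part of 1 / (1 - r) - 1 / (1 - z) at z = r exp(it), where |1 -
  z|^2 = (1 - r)^2 + 2 r (1 - cos t).\<close>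

lemma geometric_fluctuation_sums:
  assumes r: "0 \<le> r" "r < 1"
  shows "(\<lambda>N. r ^ N * (1 - cos (real N * t))) sums
           (r * (1 + r) * (1 - cos t) / ((1 - r) * ((1 - r)\<^sup>2 + 2 * r * (1 - cos t))))"
proof -
  define z where "z = of_real r * cis t"
  have z: "norm z < 1" using r by (simp add: z_def norm_mult)
  have z_pow: "Re (z ^ N) = r ^ N * cos (real N * t)" for N
    by (simp add: z_def power_mult_distrib Complex.DeMoivre flip: of_real_power)
  have "(\<lambda>N. Re (z ^ N)) sums Re (1 / (1 - z))"
    by (intro sums_Re geometric_sums z)
  moreover have "(\<lambda>N. r ^ N) sums (1 / (1 - r))"
    using r by (intro geometric_sums) simp
  ultimately have *: "(\<lambda>N. r ^ N - Re (z ^ N)) sums (1 / (1 - r) - Re (1 / (1 - z)))"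
    by (intro sums_diff)
  define c where "c = cos t"
  have D: "(1 - r * c)\<^sup>2 + (r * sin t)\<^sup>2 = (1 - r)\<^sup>2 + 2 * r * (1 - c)"
    using sin_cos_squared_add[of t] unfolding c_def by algebra
  have "c \<le> 1" by (simp add: c_def)
  then have "(1 - r)\<^sup>2 + 2 * r * (1 - c) > 0"
    using r by (intro add_pos_nonneg mult_nonneg_nonneg) auto
  then have nz: "(1 - r)\<^sup>2 + 2 * r * (1 - c) \<noteq> 0" "1 - r \<noteq> 0" using r by auto
  have "Re (1 / (1 - z)) = (1 - r * c) / ((1 - r)\<^sup>2 + 2 * r * (1 - c))"
    by (simp add: Re_divide z_def c_def[symmetric] D flip: power2_eq_square)
  also have "1 / (1 - r) - \<dots> = r * (1 + r) * (1 - c) / ((1 - r) * ((1 - r)\<^sup>2 + 2 * r * (1 - c)))"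
    using nz by (simp add: diff_frac_eq) (simp add: power2_eq_square algebra_simps)
  finally show ?thesis using * by (simp add: z_pow c_def right_diff_distrib)
qed

text \<open>The drop of log |F| from the positive real axis to the point at angle t: |F(r exp(it))|
  = F(r) exp(- \<open>log_fluct \<tau> t\<close>) with r = exp(- \<tau>).\<close>

definition log_fluct :: "real \<Rightarrow> real \<Rightarrow> real" where
  "log_fluct \<tau> t = (\<Sum>N. cubic_log_coeff N * exp (- (\<tau> * N)) * (1 - cos (real N * t)))"

lemma summable_log_moment_0:
  "\<tau> > 0 \<Longrightarrow> summable (\<lambda>N. cubic_log_coeff N * exp (- (\<tau> * real N)))"
  using summable_log_moment[of \<tau> 0] by simp

lemma summable_log_fluct:
  assumes "\<tau> > 0"
  shows "summable (\<lambda>N. cubic_log_coeff N * exp (- (\<tau> * real N)) * (1 - cos (real N * t)))"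
proof (rule summable_comparison_test')
  show "summable (\<lambda>N. cubic_log_coeff N * exp (- (\<tau> * real N)) * 2)"
    by (intro summable_mult2 summable_log_moment_0 assms)
  show "norm (cubic_log_coeff N * exp (- (\<tau> * real N)) * (1 - cos (real N * t)))
      \<le> cubic_log_coeff N * exp (- (\<tau> * real N)) * 2" for N
    using cos_ge_minus_one[of "real N * t"]
    by (auto simp: abs_mult cubic_log_coeff_nonneg intro!: mult_left_mono)
qed

lemma log_fluct_nonneg: "\<tau> > 0 \<Longrightarrow> log_fluct \<tau> t \<ge> 0"
  unfolding log_fluct_def
  by (intro suminf_nonneg summable_log_fluct) (auto simp: cubic_log_coeff_nonneg)

text \<open>All terms are nonnegative and all coefficients with N > 0 are at least 2, so twice the
  geometric fluctuation is a lower bound. Its closed form increases with 1 - cos t, which is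
  replaced by t^2 / 18, and 1 - r is replaced by \<tau>.\<close>

lemma log_fluct_ge:
  assumes \<tau>: "0 < \<tau>" "\<tau> \<le> 1 / 2" and t: "\<bar>t\<bar> \<le> pi"
  shows "log_fluct \<tau> t \<ge> t\<^sup>2 / (2 * \<tau> * (9 * \<tau>\<^sup>2 + t\<^sup>2))"
proof -
  define r where "r = exp (- \<tau>)"
  have r: "1 / 2 \<le> r" "r < 1" "1 - r \<le> \<tau>" 
    using exp_ge_add_one_self[of "- \<tau>"] \<tau> by (auto simp: r_def)
  define y where "y = t\<^sup>2 / 18"
  define x where "x = 1 - cos t"
  have y: "0 \<le> y" "y \<le> x" using one_minus_cos_ge[OF t] by (auto simp: x_def y_def)
  have "t\<^sup>2 / (2 * \<tau> * (9 * \<tau>\<^sup>2 + t\<^sup>2)) = 9 * y / (\<tau> * (9 * \<tau>\<^sup>2 + 18 * y))"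
    by (simp add: y_def field_simps)
  also have "\<dots> = y / (\<tau> * (\<tau>\<^sup>2 + 2 * y))"
  proof -
    have "\<tau> * (9 * \<tau>\<^sup>2 + 18 * y) = 9 * (\<tau> * (\<tau>\<^sup>2 + 2 * y))" by (simp add: algebra_simps)
    then show ?thesis by (metis mult_divide_mult_cancel_left zero_neq_numeral)
  qed
  also have "\<dots> \<le> y / ((1 - r) * ((1 - r)\<^sup>2 + 2 * r * y))"
    using r y \<tau> by (intro divide_left_mono mult_mono add_mono power_mono mult_pos_pos add_pos_nonneg mult_right_mono) auto
  also have "\<dots> \<le> x / ((1 - r) * ((1 - r)\<^sup>2 + 2 * r * x))"
  proof -
    have pos: "(1 - r)\<^sup>2 + 2 * r * y > 0" "(1 - r)\<^sup>2 + 2 * r * x > 0"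
      using r y by (auto intro!: add_pos_nonneg)
    have "y * (1 - r)\<^sup>2 \<le> x * (1 - r)\<^sup>2" using y by (intro mult_right_mono) auto
    \<comment> \<open>The map y \<mapsto> y / (c + 2 r y) is increasing.\<close>
    then have "y / ((1 - r)\<^sup>2 + 2 * r * y) \<le> x / ((1 - r)\<^sup>2 + 2 * r * x)"
    proof -
      have "y * ((1 - r)\<^sup>2 + 2 * r * x) \<le> x * ((1 - r)\<^sup>2 + 2 * r * y)"
        using \<open>y * (1 - r)\<^sup>2 \<le> x * (1 - r)\<^sup>2\<close> by (simp add: algebra_simps)
      then have "y \<le> x * ((1 - r)\<^sup>2 + 2 * r * y) / ((1 - r)\<^sup>2 + 2 * r * x)"
        using pos by (intro mult_imp_le_div_pos)
      then show ?thesis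
        using pos by (intro mult_imp_div_pos_le) auto
    qed
    then have "y / ((1 - r)\<^sup>2 + 2 * r * y) / (1 - r) \<le> x / ((1 - r)\<^sup>2 + 2 * r * x) / (1 - r)"
      using r by (intro divide_right_mono) auto
    then show ?thesis by (simp add: mult.commute)
  qed
  \<comment> \<open>Here \<tau> \<le> 1 / 2 matters: it gives r \<ge> 1 / 2, so the factor 2 from
    the coefficients makes up for r (1 + r).\<close>
  also have "\<dots> \<le> 2 * (r * (1 + r)) * (x / ((1 - r) * ((1 - r)\<^sup>2 + 2 * r * x)))"
  proof -
    have "1 / 2 * 1 \<le> r * (1 + r)" using r by (intro mult_mono) auto
    then have "1 \<le> 2 * (r * (1 + r))" by simp
    moreover have "0 \<le> x / ((1 - r) * ((1 - r)\<^sup>2 + 2 * r * x))" using r y by auto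
    ultimately show ?thesis by (metis mult_right_mono mult_1)
  qed
  also have "\<dots> = 2 * (r * (1 + r) * x / ((1 - r) * ((1 - r)\<^sup>2 + 2 * r * x)))" by simp
  also have "\<dots> = 2 * (\<Sum>N. r ^ N * (1 - cos (real N * t)))"
    using geometric_fluctuation_sums[of r t] r by (simp add: sums_iff x_def)
  also have "\<dots> = (\<Sum>N. 2 * (r ^ N * (1 - cos (real N * t))))"
    using geometric_fluctuation_sums[of r t] r by (intro suminf_mult[symmetric]) (auto simp: sums_iff)
  also have "\<dots> \<le> log_fluct \<tau> t"
    unfolding log_fluct_def
  proof (intro suminf_le summable_log_fluct)
    fix N
    have "2 * (1 - cos (real N * t)) \<le> cubic_log_coeff N * (1 - cos (real N * t))"
    proof (cases "N = 0")
      case False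
      then show ?thesis using cubic_log_coeff_ge_2[of N] by (intro mult_right_mono) auto
    qed simp
    then have "exp (- (\<tau> * N)) * (2 * (1 - cos (real N * t))) \<le> exp (- (\<tau> * N)) * (cubic_log_coeff N * (1 - cos (real N * t)))"
      by (rule mult_left_mono) simp
    then show "2 * (r ^ N * (1 - cos (real N * t))) \<le> cubic_log_coeff N * exp (- (\<tau> * real N)) * (1 - cos (real N * t))"
      by (simp add: r_def mult_ac flip: exp_of_nat_mult)
  next
    show "summable (\<lambda>N. 2 * (r ^ N * (1 - cos (real N * t))))"
      using geometric_fluctuation_sums[of r t] r by (intro summable_mult) (auto simp: sums_iff)
  qed (use \<tau> in auto)
  finally show ?thesis .
qed

lemma log_fluct_le:
  assumes "\<tau> > 0"
  shows "log_fluct \<tau> t \<le> log_moment 2 \<tau> * t\<^sup>2 / 2"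
proof -
  have "log_fluct \<tau> t \<le> (\<Sum>N. cubic_log_coeff N * real N ^ 2 * exp (- (\<tau> * real N)) * (t\<^sup>2 / 2))"
    unfolding log_fluct_def
  proof (intro suminf_le summable_log_fluct summable_mult2 summable_log_moment assms)
    fix N
    have "1 - cos (real N * t) \<le> (real N * t)\<^sup>2 / 2"
    proof -
      have "1 - cos (real N * t) = 2 * (sin (real N * t / 2))\<^sup>2"
        using cos_double_sin[of "real N * t / 2"] by simp
      also have "(sin (real N * t / 2))\<^sup>2 \<le> (real N * t / 2)\<^sup>2"
        by (metis abs_sin_x_le_abs_x abs_le_square_iff)
      finally show ?thesis by (simp add: power_divide)
    qed
    then have "cubic_log_coeff N * exp (- (\<tau> * real N)) * (1 - cos (real N * t)) \<le>
        cubic_log_coeff N * exp (- (\<tau> * real N)) * ((real N * t)\<^sup>2 / 2)"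
      by (intro mult_left_mono) (auto simp: cubic_log_coeff_nonneg)
    then show "cubic_log_coeff N * exp (- (\<tau> * real N)) * (1 - cos (real N * t)) \<le>
        cubic_log_coeff N * real N ^ 2 * exp (- (\<tau> * real N)) * (t\<^sup>2 / 2)"
      by (simp add: power_mult_distrib mult_ac)
  qed
  also have "\<dots> = log_moment 2 \<tau> * (t\<^sup>2 / 2)"
    unfolding log_moment_def by (intro suminf_mult2[symmetric] summable_log_moment assms)
  finally show ?thesis by simp
qed

text \<open>The second moment bounds the fluctuation from above, so the lower bound for the
  fluctuation at t = \<tau> bounds the second moment from below.\<close>

lemma log_moment_2_ge:
  assumes \<tau>: "0 < \<tau>" "\<tau> \<le> 1 / 2"
  shows "log_moment 2 \<tau> \<ge> 1 / (10 * \<tau> ^ 3)"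
proof -
  have "\<tau>\<^sup>2 / (2 * \<tau> * (9 * \<tau>\<^sup>2 + \<tau>\<^sup>2)) \<le> log_moment 2 \<tau> * \<tau>\<^sup>2 / 2"
    using \<tau> pi_ge_two by (intro order_trans[OF log_fluct_ge log_fluct_le]) auto
  also have "\<tau>\<^sup>2 / (2 * \<tau> * (9 * \<tau>\<^sup>2 + \<tau>\<^sup>2)) = 1 / (20 * \<tau>)"
    using \<tau> by (simp add: divide_simps) 
  finally have "1 / (20 * \<tau>) * (2 / \<tau>\<^sup>2) \<le> log_moment 2 \<tau> * \<tau>\<^sup>2 / 2 * (2 / \<tau>\<^sup>2)"
    using \<tau> by (intro mult_right_mono) auto
  then show ?thesis using \<tau> by (simp add: power2_eq_square power3_eq_cube)
qed

text \<open>With \<open>t = u / sqrt (log_moment 2 \<tau>)\<close>, the fluctuation is at least a constant times \<open>u\<^sup>2\<close> when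
  \<open>\<bar>t\<bar> \<le> \<tau>\<close>, and at least \<open>1 / (20 * \<tau>)\<close> otherwise, where \<open>u\<^sup>2\<close> is at most a constant times \<open>1 / \<tau> ^ 3\<close>.\<close>
lemma exp_minus_log_fluct_bound:
  obtains B where "\<And>\<tau> u. 0 < \<tau> \<Longrightarrow> \<tau> \<le> 1 / 2 \<Longrightarrow> \<bar>u / sqrt (log_moment 2 \<tau>)\<bar> \<le> pi \<Longrightarrow>
    exp (- log_fluct \<tau> (u / sqrt (log_moment 2 \<tau>))) * (1 + \<bar>u\<bar>) ^ m \<le> B"
proof -
  define K where "K = moment_const 2"
  have K: "K > 0" by (simp add: K_def moment_const_pos)
  \<comment> \<open>16 * 20^3 * K: far from the saddle point t^2 \<le> 16 and 1 / \<tau> \<le> 20 E.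
    Near it, 20 K would suffice.\<close>
  define C where "C = 128000 * K"
  define D where "D = 2 * (1 + C)"
  define k where "k = 3 * m"
  show ?thesis
  proof (rule that[of "D ^ m * (fact k * exp 1)"])
    fix \<tau> u :: real
    assume \<tau>: "0 < \<tau>" "\<tau> \<le> 1 / 2" and t_pi: "\<bar>u / sqrt (log_moment 2 \<tau>)\<bar> \<le> pi"
    define t where "t = u / sqrt (log_moment 2 \<tau>)"
    define E where "E = log_fluct \<tau> t"
    have E0: "E \<ge> 0" using \<tau> by (simp add: E_def log_fluct_nonneg)
    have E: "E \<ge> t\<^sup>2 / (2 * \<tau> * (9 * \<tau>\<^sup>2 + t\<^sup>2))"
      unfolding E_def using \<tau> t_pi by (intro log_fluct_ge) (auto simp: t_def)
    have V: "log_moment 2 \<tau> > 0"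
      using \<tau> by (intro less_le_trans[OF _ log_moment_2_ge]) auto
    have "u\<^sup>2 = log_moment 2 \<tau> * t\<^sup>2" using V by (simp add: t_def power_divide)
    also have "\<dots> \<le> K / \<tau> ^ 3 * t\<^sup>2"
      using log_moment_le[of \<tau> 2] \<tau> by (intro mult_right_mono) (auto simp: K_def eval_nat_numeral)
    also have "\<dots> \<le> C * (1 + E) ^ 3"
    proof (cases "\<bar>t\<bar> \<le> \<tau>")
      case True
      then have "t\<^sup>2 \<le> \<tau>\<^sup>2" using abs_le_square_iff[of t \<tau>] \<tau> by simp
      then have "t\<^sup>2 / (2 * \<tau> * (9 * \<tau>\<^sup>2 + \<tau>\<^sup>2)) \<le> t\<^sup>2 / (2 * \<tau> * (9 * \<tau>\<^sup>2 + t\<^sup>2))"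
        using \<tau> by (intro divide_left_mono mult_left_mono add_left_mono mult_pos_pos add_pos_nonneg) auto
      also have "t\<^sup>2 / (2 * \<tau> * (9 * \<tau>\<^sup>2 + \<tau>\<^sup>2)) = t\<^sup>2 / \<tau> ^ 3 / 20"
        by (simp add: power2_eq_square power3_eq_cube)
      finally have "t\<^sup>2 / \<tau> ^ 3 \<le> 20 * E" using E by simp
      then have "K * (t\<^sup>2 / \<tau> ^ 3) \<le> K * (20 * E)" using K by (intro mult_left_mono) auto
      also have "\<dots> \<le> C * (1 + E)" using K E0 by (simp add: C_def algebra_simps)
      also have "\<dots> \<le> C * (1 + E) ^ 3"
        using K E0 by (intro mult_left_mono self_le_power) (auto simp: C_def)
      finally show ?thesis by simp
    next
      case False
      then have "\<tau>\<^sup>2 \<le> t\<^sup>2" using abs_le_square_iff[of \<tau> t] \<tau> by simp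
      then have "1 / (20 * \<tau>) \<le> t\<^sup>2 / (2 * \<tau> * (9 * \<tau>\<^sup>2 + t\<^sup>2))"
      proof -
        have "2 * \<tau> * (9 * \<tau>\<^sup>2 + t\<^sup>2) \<le> 2 * \<tau> * (10 * t\<^sup>2)"
          using \<tau> \<open>\<tau>\<^sup>2 \<le> t\<^sup>2\<close> by (intro mult_left_mono) auto
        moreover have "9 * \<tau>\<^sup>2 + t\<^sup>2 > 0" using \<tau> by (intro add_pos_nonneg) auto
        ultimately have "t\<^sup>2 / (2 * \<tau> * (10 * t\<^sup>2)) \<le> t\<^sup>2 / (2 * \<tau> * (9 * \<tau>\<^sup>2 + t\<^sup>2))"
          using \<tau> False by (intro divide_left_mono mult_pos_pos) auto
        moreover have "t \<noteq> 0" using False \<tau> by auto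
        ultimately show ?thesis by simp
      qed
      then have "1 / \<tau> \<le> 20 * E" using E by simp
      then have *: "(1 / \<tau>) ^ 3 \<le> (20 * E) ^ 3" using \<tau> by (intro power_mono) auto
      have "t\<^sup>2 \<le> 4\<^sup>2" using t_pi pi_less_4 abs_le_square_iff[of t 4] by (simp add: t_def)
      then have "K / \<tau> ^ 3 * t\<^sup>2 \<le> K / \<tau> ^ 3 * 16"
        using K \<tau> by (intro mult_left_mono) auto
      also have "\<dots> = 16 * K * (1 / \<tau>) ^ 3" by (simp add: power_divide)
      also have "\<dots> \<le> 16 * K * (20 * E) ^ 3" using * K by (intro mult_left_mono) auto
      also have "\<dots> = C * E ^ 3" by (simp add: C_def power_mult_distrib)
      also have "\<dots> \<le> C * (1 + E) ^ 3"
        using K E0 by (intro mult_left_mono power_mono) (auto simp: C_def)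
      finally show ?thesis .
    qed
    finally have u2: "u\<^sup>2 \<le> C * (1 + E) ^ 3" .
    \<comment> \<open>As u^2 is at most cubic in E, the power of 1 + |u| is bounded by a polynomial
      in E, which \<open>exp (- E)\<close> absorbs.\<close>
    have "1 + \<bar>u\<bar> \<le> (1 + \<bar>u\<bar>)\<^sup>2" by (intro self_le_power) auto
    also have "\<dots> \<le> 2 * (1 + u\<^sup>2)"
      using zero_le_power2[of "1 - \<bar>u\<bar>"] by (simp add: power2_eq_square algebra_simps)
    also have "\<dots> \<le> D * (1 + E) ^ 3"
    proof -
      have "1 \<le> (1 + E) ^ 3" using E0 by simp
      then have "1 + u\<^sup>2 \<le> (1 + C) * (1 + E) ^ 3" using u2 by (simp add: distrib_right)
      then have "2 * (1 + u\<^sup>2) \<le> 2 * ((1 + C) * (1 + E) ^ 3)" by (rule mult_left_mono) simp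
      then show ?thesis by (simp only: D_def mult.assoc)
    qed
    finally have "(1 + \<bar>u\<bar>) ^ m \<le> (D * (1 + E) ^ 3) ^ m" by (intro power_mono) auto
    also have "\<dots> = D ^ m * (1 + E) ^ k"
      by (simp add: power_mult_distrib k_def power_mult)
    also have "\<dots> \<le> D ^ m * (fact k * exp (1 + E))"
      using E0 K by (intro mult_left_mono power_le_fact_mult_exp) (auto simp: D_def C_def)
    also have "\<dots> = D ^ m * (fact k * exp 1) * exp E" by (simp add: exp_add)
    finally have "exp (- E) * (1 + \<bar>u\<bar>) ^ m \<le> exp (- E) * (D ^ m * (fact k * exp 1) * exp E)"
      by (intro mult_left_mono) auto
    also have "\<dots> = D ^ m * (fact k * exp 1)" by (simp add: exp_minus)
    finally show "exp (- log_fluct \<tau> (u / sqrt (log_moment 2 \<tau>))) * (1 + \<bar>u\<bar>) ^ m \<le> D ^ m * (fact k * exp 1)"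
      by (simp add: E_def t_def)
  qed
qed

section \<open>Expansion of the logarithm at the saddle point\<close>

definition log_gf :: "real \<Rightarrow> real \<Rightarrow> complex" where
  "log_gf \<tau> t = (\<Sum>N. of_real (cubic_log_coeff N) * (of_real (exp (- \<tau>)) * cis t) ^ N)"

lemma log_gf_sums:
  assumes "\<tau> > 0"
  shows "(\<lambda>N. of_real (cubic_log_coeff N * exp (- (\<tau> * real N))) * cis (real N * t)) sums log_gf \<tau> t"
proof -
  have "norm (of_real (exp (- \<tau>)) * cis t) < 1" using assms by (simp add: norm_mult)
  from summable_cubic_log_coeff[OF this]
  have "(\<lambda>N. of_real (cubic_log_coeff N) * (of_real (exp (- \<tau>)) * cis t) ^ N) sums log_gf \<tau> t"
    unfolding log_gf_def by (rule summable_sums)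
  then show ?thesis
    by (simp add: power_mult_distrib Complex.DeMoivre mult_ac flip: of_real_power exp_of_nat_mult)
qed

lemma log_gf_0:
  assumes "\<tau> > 0"
  shows "log_gf \<tau> 0 = of_real (log_moment 0 \<tau>)"
proof -
  have "(\<lambda>N. complex_of_real (cubic_log_coeff N * exp (- (\<tau> * real N)))) sums of_real (log_moment 0 \<tau>)"
    unfolding log_moment_def using summable_log_moment_0[OF assms]
    by (intro sums_of_real) (simp add: summable_sums)
  then show ?thesis using log_gf_sums[OF assms, of 0] by (simp add: sums_unique2)
qed

lemma Re_log_gf:
  assumes "\<tau> > 0"
  shows "Re (log_gf \<tau> t) = log_moment 0 \<tau> - log_fluct \<tau> t"
proof -
  have "(\<lambda>N. cubic_log_coeff N * exp (- (\<tau> * real N)) - cubic_log_coeff N * exp (- (\<tau> * real N)) * (1 - cos (real N * t)))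
      sums (log_moment 0 \<tau> - log_fluct \<tau> t)"
    unfolding log_moment_def log_fluct_def
    using summable_log_moment_0[OF assms] summable_log_fluct[OF assms]
    by (intro sums_diff) (auto simp: summable_sums)
  moreover have "(\<lambda>N. Re (of_real (cubic_log_coeff N * exp (- (\<tau> * real N))) * cis (real N * t))) sums Re (log_gf \<tau> t)"
    by (intro sums_Re log_gf_sums assms)
  ultimately show ?thesis by (simp add: right_diff_distrib sums_unique2)
qed

text \<open>Each exponential is expanded to second order with remainder |N t|^3 / 6. The weights are
  nonnegative, so the remainders add up to the third moment.\<close>

lemma log_gf_expansion:
  assumes \<tau>: "\<tau> > 0"
  shows "norm (log_gf \<tau> t - log_gf \<tau> 0 - \<i> * of_real (log_moment 1 \<tau> * t) + of_real (log_moment 2 \<tau> * t\<^sup>2 / 2))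
           \<le> log_moment 3 \<tau> * \<bar>t\<bar> ^ 3 / 6"
proof -
  define w where "w = (\<lambda>N. cubic_log_coeff N * exp (- (\<tau> * real N)))"
  have w: "w N \<ge> 0" for N by (simp add: w_def cubic_log_coeff_nonneg)
  have mom: "(\<lambda>N. w N * real N ^ p) sums log_moment p \<tau>" for p
    using summable_sums[OF summable_log_moment[OF \<tau>, of p]]
    by (simp add: log_moment_def w_def mult_ac)
  define f where "f = (\<lambda>N. of_real (w N) * (iexp (real N * t) - (\<Sum>k\<le>2. (\<i> * (real N * t)) ^ k / fact k)))"
  have "(\<lambda>N. of_real (w N) * cis (real N * t) - of_real (w N) * cis (real N * 0)
        - \<i> * of_real (w N * real N ^ 1 * t) + of_real (w N * real N ^ 2 * (t\<^sup>2 / 2))) sums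
      (log_gf \<tau> t - log_gf \<tau> 0 - \<i> * of_real (log_moment 1 \<tau> * t) + of_real (log_moment 2 \<tau> * (t\<^sup>2 / 2)))"
    unfolding w_def
    by (intro sums_add sums_diff sums_mult sums_of_real sums_mult2 log_gf_sums \<tau> mom[unfolded w_def])
  also have "(\<lambda>N. of_real (w N) * cis (real N * t) - of_real (w N) * cis (real N * 0)
        - \<i> * of_real (w N * real N ^ 1 * t) + of_real (w N * real N ^ 2 * (t\<^sup>2 / 2))) = f"
    by (auto simp: f_def fun_eq_iff cis_conv_exp numeral_2_eq_2 algebra_simps power_mult_distrib)
  finally have f: "f sums (log_gf \<tau> t - log_gf \<tau> 0 - \<i> * of_real (log_moment 1 \<tau> * t) + of_real (log_moment 2 \<tau> * (t\<^sup>2 / 2)))" .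
  have le: "norm (f N) \<le> w N * real N ^ 3 * (\<bar>t\<bar> ^ 3 / 6)" for N
  proof -
    have "norm (f N) = w N * norm (iexp (real N * t) - (\<Sum>k\<le>2. (\<i> * (real N * t)) ^ k / fact k))"
      using w[of N] by (simp add: f_def norm_mult)
    also have "\<dots> \<le> w N * (\<bar>real N * t\<bar> ^ Suc 2 / fact (Suc 2))"
      by (intro mult_left_mono iexp_approx1 w)
    finally show ?thesis by (simp add: abs_mult power_mult_distrib fact_numeral mult_ac del: power_Suc)
  qed
  have sums3: "(\<lambda>N. w N * real N ^ 3 * (\<bar>t\<bar> ^ 3 / 6)) sums (log_moment 3 \<tau> * (\<bar>t\<bar> ^ 3 / 6))"
    by (intro sums_mult2 mom)
  have "summable (\<lambda>N. norm (f N))"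
    using le by (intro summable_comparison_test'[OF sums_summable[OF sums3]]) auto
  then have "norm (suminf f) \<le> (\<Sum>N. norm (f N))" by (rule summable_norm)
  also have "\<dots> \<le> log_moment 3 \<tau> * (\<bar>t\<bar> ^ 3 / 6)"
    using sums_unique[OF sums3] suminf_le[OF le \<open>summable (\<lambda>N. norm (f N))\<close> sums_summable[OF sums3]]
    by simp
  finally show ?thesis using f by (simp add: sums_iff)
qed

section \<open>Jensen polynomials as integrals\<close>

lemma has_bochner_integral_cis_int:
  fixes k :: int
  shows "has_bochner_integral lborel (\<lambda>t. indicator {-pi..pi} t *\<^sub>R cis (of_int k * t))
           (if k = 0 then 2 * of_real pi else 0)"
proof (cases "k = 0")
  case True
  have "has_bochner_integral lborel (\<lambda>t. indicator {-pi..pi} t *\<^sub>R (1::complex)) (measure lborel {-pi..pi} *\<^sub>R 1)"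
    by (intro has_bochner_integral_scaleR_left has_bochner_integral_real_indicator) auto
  with True show ?thesis by (simp add: scaleR_conv_of_real)
next
  case False
  define F where "F = (\<lambda>t. cis (of_int k * t) / (\<i> * of_int k))"
  have i_i: "\<i> * (a * (\<i> * b)) = - (a * b)" for a b
    by (simp add: complex_eq_iff)
  have "(F has_vector_derivative cis (of_int k * t)) (at t within {-pi..pi})" for t
    using False unfolding F_def
    by (auto intro!: derivative_eq_intros simp: has_vector_derivative_def scaleR_conv_of_real fun_eq_iff i_i)
  then have "has_bochner_integral lborel (\<lambda>t. indicator {-pi..pi} t *\<^sub>R cis (of_int k * t)) (F pi - F (- pi))"
    by (intro has_bochner_integral_FTC_Icc) (auto intro!: continuous_intros)
  also have "F pi - F (- pi) = 0"
  proof -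
    have "sin (of_int k * pi) = 0" by (simp add: sin_times_pi_eq_0)
    then show ?thesis by (simp add: F_def cis.code)
  qed
  finally show ?thesis using False by simp
qed

text \<open>Absolute summability on the circle permits termwise integration, and orthogonality
  leaves the term \<open>k = n\<close>.\<close>

lemma fourier_coefficient:
  fixes a :: "nat \<Rightarrow> real"
  assumes summable: "summable (\<lambda>k. \<bar>a k\<bar> * r ^ k)" and r: "r \<ge> 0"
    and f: "\<And>t. (\<lambda>k. of_real (a k) * (of_real r * cis t) ^ k) sums f t"
  shows "has_bochner_integral lborel (\<lambda>t. indicator {-pi..pi} t *\<^sub>R (f t * cis (- (real n * t))))
           (of_real (2 * pi * (a n * r ^ n)))"
proof -
  define g where "g = (\<lambda>k t. of_real (a k * r ^ k) * (indicator {-pi..pi} t *\<^sub>R cis (of_int (int k - int n) * t)))"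
  define h where "h = (\<lambda>t. indicator {-pi..pi} t *\<^sub>R (f t * cis (- (real n * t))))"
  have g_int: "has_bochner_integral lborel (g k) (of_real (a k * r ^ k) * (if int k - int n = 0 then 2 * of_real pi else 0))" for k
    unfolding g_def by (intro has_bochner_integral_mult_right has_bochner_integral_cis_int)
  have g_sums: "(\<lambda>k. g k t) sums h t" for t
  proof -
    have "(\<lambda>k. (of_real (a k) * (of_real r * cis t) ^ k) * cis (- (real n * t))) sums (f t * cis (- (real n * t)))"
      by (intro sums_mult2 f)
    then have "(\<lambda>k. indicator {-pi..pi} t *\<^sub>R ((of_real (a k) * (of_real r * cis t) ^ k) * cis (- (real n * t)))) sums h t"
      unfolding h_def by (rule sums_scaleR_right)
    also have "(\<lambda>k. indicator {-pi..pi} t *\<^sub>R ((of_real (a k) * (of_real r * cis t) ^ k) * cis (- (real n * t)))) = (\<lambda>k. g k t)"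
      by (auto simp: g_def fun_eq_iff power_mult_distrib Complex.DeMoivre cis_mult algebra_simps split: split_indicator)
    finally show ?thesis .
  qed
  have norm_g: "norm (g k t) = \<bar>a k\<bar> * r ^ k * indicator {-pi..pi} t" for k t
    using r by (simp add: g_def norm_mult norm_power abs_mult split: split_indicator)
  have "summable (\<lambda>k. norm (g k t))" for t
    unfolding norm_g by (intro summable_mult2 summable)
  moreover have "(\<integral>t. norm (g k t) \<partial>lborel) = \<bar>a k\<bar> * r ^ k * (2 * pi)" for k
    by (simp add: norm_g)
  then have "summable (\<lambda>k. \<integral>t. norm (g k t) \<partial>lborel)"
    using summable_mult2[OF summable, of "2 * pi"] by simp
  ultimately have "integrable lborel (\<lambda>t. \<Sum>k. g k t)"
    and "(\<lambda>k. integral\<^sup>L lborel (g k)) sums (\<integral>t. (\<Sum>k. g k t) \<partial>lborel)"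
    using g_int by (auto intro!: integrable_suminf sums_integral intro: integrable.intros)
  moreover have "(\<lambda>t. \<Sum>k. g k t) = h" using g_sums by (auto simp: sums_iff fun_eq_iff)
  moreover have "(\<lambda>k. integral\<^sup>L lborel (g k)) = (\<lambda>k. if k = n then of_real (2 * pi * (a k * r ^ k)) else 0)"
    using g_int[THEN has_bochner_integral_integral_eq] by (auto simp: fun_eq_iff)
  ultimately have "integrable lborel h" "(\<lambda>k. if k = n then of_real (2 * pi * (a k * r ^ k)) else 0) sums integral\<^sup>L lborel h"
    by simp_all
  moreover have "(\<lambda>k. if k = n then of_real (2 * pi * (a k * r ^ k)) else 0 :: complex) sums of_real (2 * pi * (a n * r ^ n))"
    by (rule sums_single)
  ultimately show ?thesis
    unfolding h_def[symmetric] by (auto simp: has_bochner_integral_iff dest: sums_unique2)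
qed

lemma cubic_overpartition_fourier:
  assumes \<tau>: "\<tau> > 0"
  shows "has_bochner_integral lborel (\<lambda>t. indicator {-pi..pi} t *\<^sub>R (exp (log_gf \<tau> t) * cis (- (real n * t))))
           (of_real (2 * pi * (cubic_overpartition n * exp (- \<tau>) ^ n)))"
proof (rule fourier_coefficient)
  \<comment> \<open>Convergence at this larger radius yields absolute convergence at radius
    \<open>exp (- \<tau>)\<close>.\<close>
  define \<rho> where "\<rho> = exp (- (\<tau> / 2))"
  have "summable (\<lambda>n. complex_of_real (cubic_overpartition n) * of_real \<rho> ^ n)"
    using cubic_overpartition_sums[of "of_real \<rho>"] \<tau> by (auto simp: \<rho>_def sums_iff)
  from powser_insidea[OF this, of "of_real (exp (- \<tau>))"]
  show "summable (\<lambda>k. \<bar>cubic_overpartition k\<bar> * exp (- \<tau>) ^ k)"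
    using \<tau> by (simp add: \<rho>_def norm_mult norm_power)
  show "(\<lambda>k. complex_of_real (cubic_overpartition k) * (of_real (exp (- \<tau>)) * cis t) ^ k) sums exp (log_gf \<tau> t)" for t
    unfolding log_gf_def using \<tau> by (intro cubic_overpartition_sums) (simp add: norm_mult)
qed simp

text \<open>Passing from n to n + i multiplies the integrand by \<open>cis (- t) ^ i\<close>, so the
  binomial theorem sums the coefficients under the integral. Evaluating at \<open>r * x\<close>
  absorbs the powers \<open>r ^ i\<close>.\<close>

lemma jensen_integral:
  assumes \<tau>: "\<tau> > 0"
  defines "r \<equiv> exp (- \<tau>)"
  shows "has_bochner_integral lborel
           (\<lambda>t. indicator {-pi..pi} t *\<^sub>R (exp (log_gf \<tau> t) * cis (- (real n * t)) * (1 + of_real x * cis (- t)) ^ d))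
           (of_real (2 * pi * r ^ n * poly (jensen_poly cubic_overpartition d n) (r * x)))"
proof -
  have "has_bochner_integral lborel
     (\<lambda>t. \<Sum>i\<le>d. of_real (of_nat (d choose i) * x ^ i) * (indicator {-pi..pi} t *\<^sub>R (exp (log_gf \<tau> t) * cis (- (real (n + i) * t)))))
     (\<Sum>i\<le>d. of_real (of_nat (d choose i) * x ^ i) * of_real (2 * pi * (cubic_overpartition (n + i) * r ^ (n + i))))"
    unfolding r_def
    by (intro has_bochner_integral_sum has_bochner_integral_mult_right cubic_overpartition_fourier \<tau>)
  also have "(\<lambda>t. \<Sum>i\<le>d. of_real (of_nat (d choose i) * x ^ i) * (indicator {-pi..pi} t *\<^sub>R (exp (log_gf \<tau> t) * cis (- (real (n + i) * t))))) =
    (\<lambda>t. indicator {-pi..pi} t *\<^sub>R (exp (log_gf \<tau> t) * cis (- (real n * t)) * (1 + of_real x * cis (- t)) ^ d))"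
  proof
    fix t
    have "(1 + of_real x * cis (- t)) ^ d = (\<Sum>i\<le>d. of_nat (d choose i) * (of_real x * cis (- t)) ^ i)"
      using binomial_ring[of "of_real x * cis (- t)" 1 d] by (simp add: add.commute)
    moreover have "cis (- (real (n + i) * t)) = cis (- (real n * t)) * cis (- t) ^ i" for i
      by (simp add: Complex.DeMoivre cis_mult algebra_simps)
    ultimately show "(\<Sum>i\<le>d. of_real (of_nat (d choose i) * x ^ i) * (indicator {-pi..pi} t *\<^sub>R (exp (log_gf \<tau> t) * cis (- (real (n + i) * t))))) =
       indicator {-pi..pi} t *\<^sub>R (exp (log_gf \<tau> t) * cis (- (real n * t)) * (1 + of_real x * cis (- t)) ^ d)"
      by (cases "t \<in> {-pi..pi}") (simp_all add: sum_distrib_left power_mult_distrib mult_ac)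
  qed
  also have "(\<Sum>i\<le>d. of_real (of_nat (d choose i) * x ^ i) * of_real (2 * pi * (cubic_overpartition (n + i) * r ^ (n + i)))) =
     complex_of_real (2 * pi * r ^ n * poly (jensen_poly cubic_overpartition d n) (r * x))"
    by (simp add: jensen_poly_def poly_sum poly_monom sum_distrib_left power_add power_mult_distrib mult_ac)
  finally show ?thesis .
qed

text \<open>The integrand after the substitution \<open>t = s * u\<close>, normalised by its value at the saddle point;
  the Jensen polynomial is evaluated at \<open>- exp (- \<tau>) * (1 - s * y)\<close>.\<close>
definition scaled_integrand :: "nat \<Rightarrow> nat \<Rightarrow> real \<Rightarrow> real \<Rightarrow> real \<Rightarrow> real \<Rightarrow> complex" where
  "scaled_integrand d n \<tau> s y u = indicator {-pi..pi} (s * u) *\<^sub>R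
     (exp (log_gf \<tau> (s * u) - log_gf \<tau> 0 - \<i> * of_real (real n * (s * u))) *
      ((1 - of_real (1 - s * y) * cis (- (s * u))) / of_real s) ^ d)"

text \<open>The normalisation and the change of variable contribute only a positive factor,
  independent of y. Thus the limit of the integrals decides the signs of the Jensen
  polynomial.\<close>

lemma jensen_scaled_integral:
  assumes \<tau>: "\<tau> > 0" and s: "s > 0"
  obtains c :: real where "c > 0"
    "\<And>y. has_bochner_integral lborel (scaled_integrand d n \<tau> s y)
       (of_real (c * poly (jensen_poly cubic_overpartition d n) (- exp (- \<tau>) * (1 - s * y))))"
proof -
  define r where "r = exp (- \<tau>)"
  define k where "k = exp (log_moment 0 \<tau>) * s ^ d"
  define c where "c = inverse k * (inverse s * (2 * pi * r ^ n))"
  have k: "k > 0" using s by (simp add: k_def)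
  show ?thesis
  proof (rule that[of c])
    show "c > 0" using s k by (simp add: c_def r_def)
    fix y
    define f where "f = (\<lambda>t. indicator {-pi..pi} t *\<^sub>R (exp (log_gf \<tau> t) * cis (- (real n * t)) * (1 + of_real (- (1 - s * y)) * cis (- t)) ^ d))"
    define J where "J = poly (jensen_poly cubic_overpartition d n) (r * (- (1 - s * y)))"
    have "has_bochner_integral lborel f (of_real (2 * pi * r ^ n * J))"
      unfolding f_def J_def r_def by (rule jensen_integral[OF \<tau>])
    then have "has_bochner_integral lborel (\<lambda>u. f (0 + s * u)) (of_real (2 * pi * r ^ n * J) /\<^sub>R \<bar>s\<bar>)"
      using s by (subst (asm) lborel_has_bochner_integral_real_affine_iff[of s _ _ 0]) auto
    then have "has_bochner_integral lborel (\<lambda>u. of_real (inverse k) * f (0 + s * u)) (of_real (inverse k) * (of_real (2 * pi * r ^ n * J) /\<^sub>R \<bar>s\<bar>))"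
      by (rule has_bochner_integral_mult_right)
    also have "of_real (inverse k) * (of_real (2 * pi * r ^ n * J) /\<^sub>R \<bar>s\<bar>) = complex_of_real (c * J)"
      using s by (simp add: c_def scaleR_conv_of_real mult_ac)
    also have "(\<lambda>u. of_real (inverse k) * f (0 + s * u)) = scaled_integrand d n \<tau> s y"
    proof
      fix u
      have "exp (log_gf \<tau> (s * u) - log_gf \<tau> 0 - \<i> * of_real (real n * (s * u)))
          = exp (log_gf \<tau> (s * u)) * cis (- (real n * (s * u))) / of_real (exp (log_moment 0 \<tau>))"
        using \<tau> by (simp add: log_gf_0 exp_diff exp_add cis_conv_exp exp_minus exp_of_real field_simps)
      moreover have "1 + of_real (- (1 - s * y)) * cis (- (s * u)) = 1 - of_real (1 - s * y) * cis (- (s * u))"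
        by (simp add: algebra_simps)
      ultimately show "of_real (inverse k) * f (0 + s * u) = scaled_integrand d n \<tau> s y u"
        unfolding f_def scaled_integrand_def k_def add_0
        by (simp only:) (simp add: power_divide power_mult_distrib power_inverse divide_inverse mult_ac del: of_real_diff)
    qed
    finally show "has_bochner_integral lborel (scaled_integrand d n \<tau> s y)
       (of_real (c * poly (jensen_poly cubic_overpartition d n) (- exp (- \<tau>) * (1 - s * y))))"
      by (simp only: J_def r_def mult_minus_left mult_minus_right)
  qed
qed

text \<open>The saddle point equation \<open>log_moment 1 \<tau> = n\<close> cancels the linear term of the exponent.\<close>
lemma scaled_integrand_limit:
  fixes \<tau> :: "nat \<Rightarrow> real"
  assumes pos: "\<And>n. \<tau> n > 0" and lim: "\<tau> \<longlonglongrightarrow> 0"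
    and saddle: "\<And>n. n > 0 \<Longrightarrow> log_moment 1 (\<tau> n) = real n"
  defines "s \<equiv> \<lambda>n. 1 / sqrt (log_moment 2 (\<tau> n))"
  shows "(\<lambda>n. scaled_integrand d n (\<tau> n) (s n) y u) \<longlonglongrightarrow> exp (- (of_real u)\<^sup>2 / 2) * (of_real y + \<i> * of_real u) ^ d"
proof -
  have small: "\<forall>\<^sub>F n in sequentially. \<tau> n \<le> 1 / 2"
    using order_tendstoD(2)[OF lim, of "1 / 2"] by (auto elim: eventually_mono)
  \<comment> \<open>From
    \<open>log_moment 2 (\<tau> n) \<ge> 1 / (10 * \<tau> n ^ 3)\<close>.\<close>
  define A where "A = sqrt 10"
  have s_le: "\<forall>\<^sub>F n in sequentially. 0 < s n \<and> s n \<le> A * sqrt (\<tau> n ^ 3)"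
    using small
  proof eventually_elim
    case (elim n)
    have V: "1 / (10 * \<tau> n ^ 3) \<le> log_moment 2 (\<tau> n)" using pos[of n] elim by (rule log_moment_2_ge)
    have "0 < 1 / (10 * \<tau> n ^ 3)" using pos[of n] by simp
    with V have V0: "log_moment 2 (\<tau> n) > 0" by linarith
    have "s n \<le> 1 / sqrt (1 / (10 * \<tau> n ^ 3))"
      unfolding s_def using V V0 pos[of n] by (intro divide_left_mono mult_pos_pos) auto
    also have "\<dots> = A * sqrt (\<tau> n ^ 3)"
      by (simp add: A_def real_sqrt_divide real_sqrt_mult)
    finally show ?case using V0 by (simp add: s_def)
  qed
  have "(\<lambda>n. A * sqrt (\<tau> n ^ 3)) \<longlonglongrightarrow> A * sqrt (0 ^ 3)"
    by (intro tendsto_intros lim)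
  then have s0: "s \<longlonglongrightarrow> 0"
    using s_le by (intro tendsto_sandwich[of "\<lambda>_. 0" s sequentially "\<lambda>n. A * sqrt (\<tau> n ^ 3)" 0])
      (auto elim: eventually_mono)
  have su0: "(\<lambda>n. s n * u) \<longlonglongrightarrow> 0" using tendsto_mult_right[OF s0, of u] by simp
  have "(\<lambda>n. indicator {-pi..pi} (s n * u) :: real) \<longlonglongrightarrow> 1"
  proof (rule tendsto_eventually)
    have "\<forall>\<^sub>F n in sequentially. -pi < s n * u" "\<forall>\<^sub>F n in sequentially. s n * u < pi"
      using order_tendstoD[OF su0] by auto
    then show "\<forall>\<^sub>F n in sequentially. indicator {-pi..pi} (s n * u) = (1::real)"
      by eventually_elim auto
  qed
  moreover have "(\<lambda>n. exp (log_gf (\<tau> n) (s n * u) - log_gf (\<tau> n) 0 - \<i> * of_real (real n * (s n * u))))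
      \<longlonglongrightarrow> exp (- (of_real u)\<^sup>2 / 2)"
  proof (intro tendsto_exp)
    define e where "e = (\<lambda>n. log_gf (\<tau> n) (s n * u) - log_gf (\<tau> n) 0 - \<i> * of_real (real n * (s n * u)))"
    have "(\<lambda>n. e n + (of_real u)\<^sup>2 / 2) \<longlonglongrightarrow> 0"
    proof (rule Lim_null_comparison)
      define B where "B = moment_const 3 * A ^ 3 * \<bar>u\<bar> ^ 3 / 6"
      show "\<forall>\<^sub>F n in sequentially. norm (e n + (of_real u)\<^sup>2 / 2) \<le> B * sqrt (\<tau> n)"
        using s_le eventually_gt_at_top[of 0]
      proof eventually_elim
        case (elim n)
        let ?t = "s n * u"
        have V: "log_moment 2 (\<tau> n) * ?t\<^sup>2 = u\<^sup>2"
          using elim by (auto simp: s_def power_mult_distrib power_divide)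
        have "norm (log_gf (\<tau> n) ?t - log_gf (\<tau> n) 0 - \<i> * of_real (log_moment 1 (\<tau> n) * ?t) + of_real (log_moment 2 (\<tau> n) * ?t\<^sup>2 / 2))
           \<le> log_moment 3 (\<tau> n) * \<bar>?t\<bar> ^ 3 / 6"
          by (rule log_gf_expansion[OF pos])
        then have "norm (e n + (of_real u)\<^sup>2 / 2) \<le> log_moment 3 (\<tau> n) * \<bar>?t\<bar> ^ 3 / 6"
          unfolding V saddle[OF elim(2)] e_def by simp
        \<comment> \<open>The third moment has order at most \<tau>^-4 and |t|^3 order at most
          \<tau>^(9/2), which leaves sqrt \<tau>.\<close>
        also have "\<dots> \<le> moment_const 3 / \<tau> n ^ Suc 3 * (A ^ 3 * sqrt (\<tau> n ^ 3) ^ 3 * \<bar>u\<bar> ^ 3) / 6"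
        proof (intro divide_right_mono mult_mono)
          show "log_moment 3 (\<tau> n) \<le> moment_const 3 / \<tau> n ^ Suc 3" by (rule log_moment_le[OF pos])
          have "s n ^ 3 \<le> (A * sqrt (\<tau> n ^ 3)) ^ 3" using elim by (intro power_mono) auto
          then have "s n ^ 3 * \<bar>u\<bar> ^ 3 \<le> (A * sqrt (\<tau> n ^ 3)) ^ 3 * \<bar>u\<bar> ^ 3"
            by (intro mult_right_mono) auto
          then show "\<bar>?t\<bar> ^ 3 \<le> A ^ 3 * sqrt (\<tau> n ^ 3) ^ 3 * \<bar>u\<bar> ^ 3"
            using elim by (simp add: abs_mult power_mult_distrib)
        qed (use pos[of n] moment_const_pos[of 3] in auto)
        also have "sqrt (\<tau> n ^ 3) ^ 3 = \<tau> n ^ Suc 3 * sqrt (\<tau> n)"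
        proof -
          have "sqrt (\<tau> n ^ 3) ^ 3 = sqrt (\<tau> n) ^ (2 * 4 + 1)"
            by (simp add: real_sqrt_power flip: power_mult)
          also have "\<dots> = (sqrt (\<tau> n) ^ 2) ^ 4 * sqrt (\<tau> n)"
            by (simp only: power_add power_mult power_one_right)
          finally show ?thesis using pos[of n] by simp
        qed
        also have "moment_const 3 / \<tau> n ^ Suc 3 * (A ^ 3 * (\<tau> n ^ Suc 3 * sqrt (\<tau> n)) * \<bar>u\<bar> ^ 3) / 6 = B * sqrt (\<tau> n)"
          using pos[of n] by (simp add: B_def)
        finally show ?case .
      qed
      have "(\<lambda>n. B * sqrt (\<tau> n)) \<longlonglongrightarrow> B * sqrt 0" by (intro tendsto_intros lim)
      then show "(\<lambda>n. B * sqrt (\<tau> n)) \<longlonglongrightarrow> 0" by simp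
    qed
    from tendsto_diff[OF this tendsto_const[of "(of_real u)\<^sup>2 / 2"]]
    show "e \<longlonglongrightarrow> - (of_real u)\<^sup>2 / 2" by simp
  qed
  moreover have "(\<lambda>n. (1 - of_real (1 - s n * y) * cis (- (s n * u))) / of_real (s n)) \<longlonglongrightarrow> of_real y + \<i> * of_real u"
  proof -
    have s_at: "filterlim s (at 0) sequentially"
      using s0 s_le by (auto simp: filterlim_at elim: eventually_mono)
    \<comment> \<open>The quotient equals y exp(-isu) - (exp(-isu) - 1) / s, so its limit is y minus
      the derivative of z \<mapsto> exp(-iuz) at 0.\<close>
    have "((\<lambda>z. exp (- \<i> * of_real u * z)) has_field_derivative (- \<i> * of_real u)) (at 0)"
      by (auto intro!: derivative_eq_intros)
    then have lim: "((\<lambda>z. (exp (- \<i> * of_real u * z) - 1) / z) \<longlongrightarrow> - \<i> * of_real u) (at 0)"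
      by (simp add: DERIV_def)
    have "filterlim (\<lambda>n. complex_of_real (s n)) (at 0) sequentially"
      using s_at by (auto simp: filterlim_at tendsto_of_real_iff[of _ 0, simplified])
    from filterlim_compose[OF lim this]
    have 1: "(\<lambda>n. (cis (- (s n * u)) - 1) /\<^sub>R s n) \<longlonglongrightarrow> - \<i> * of_real u"
      by (simp add: cis_conv_exp scaleR_conv_of_real divide_inverse mult_ac)
    have 2: "(\<lambda>n. cis (- (s n * u))) \<longlonglongrightarrow> cis (- 0)"
      unfolding cis_conv_exp using su0 by (intro tendsto_intros)
    have "(\<lambda>n. of_real y * cis (- (s n * u)) - (cis (- (s n * u)) - 1) /\<^sub>R s n) \<longlonglongrightarrow> of_real y * cis (- 0) - (- \<i> * of_real u)"
      by (intro tendsto_intros 1 2)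
    moreover have "\<forall>\<^sub>F n in sequentially. of_real y * cis (- (s n * u)) - (cis (- (s n * u)) - 1) /\<^sub>R s n
        = (1 - of_real (1 - s n * y) * cis (- (s n * u))) / of_real (s n)"
      using s_le by eventually_elim (simp add: scaleR_conv_of_real field_simps)
    ultimately show ?thesis by (simp add: Lim_transform_eventually)
  qed
  ultimately have "(\<lambda>n. scaled_integrand d n (\<tau> n) (s n) y u) \<longlonglongrightarrow>
      1 *\<^sub>R (exp (- (of_real u)\<^sup>2 / 2) * (of_real y + \<i> * of_real u) ^ d)"
    unfolding scaled_integrand_def by (intro tendsto_scaleR tendsto_mult tendsto_power)
  then show ?thesis by simp
qed

text \<open>Of the exponent \<open>d + 2\<close> in the decay estimate, d pays for the growth of the
  polynomial factor and 2 leaves an integrable majorant.\<close>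

lemma scaled_integrand_bound:
  obtains B where "\<And>\<tau> n u. 0 < \<tau> \<Longrightarrow> \<tau> \<le> 1 / 2 \<Longrightarrow>
    norm (scaled_integrand d n \<tau> (1 / sqrt (log_moment 2 \<tau>)) y u) \<le> B * inverse (1 + u\<^sup>2)"
proof -
  obtain B where B: "\<And>\<tau> u. 0 < \<tau> \<Longrightarrow> \<tau> \<le> 1 / 2 \<Longrightarrow> \<bar>u / sqrt (log_moment 2 \<tau>)\<bar> \<le> pi \<Longrightarrow>
    exp (- log_fluct \<tau> (u / sqrt (log_moment 2 \<tau>))) * (1 + \<bar>u\<bar>) ^ (d + 2) \<le> B"
    using exp_minus_log_fluct_bound[of "d + 2"] by blast
  show ?thesis
  proof (rule that[of "B * (1 + \<bar>y\<bar>) ^ d"])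
    fix \<tau> u :: real and n :: nat
    assume \<tau>: "0 < \<tau>" "\<tau> \<le> 1 / 2"
    define s where "s = 1 / sqrt (log_moment 2 \<tau>)"
    have "log_moment 2 \<tau> > 0"
      using \<tau> by (intro less_le_trans[OF _ log_moment_2_ge]) auto
    then have s: "s > 0" by (simp add: s_def)
    have B0: "B \<ge> 0"
      using B[OF \<tau>, of 0] by (simp add: order_trans[OF exp_ge_zero])
    have u_pos: "1 + u\<^sup>2 > 0" by (intro add_pos_nonneg) auto
    show "norm (scaled_integrand d n \<tau> (1 / sqrt (log_moment 2 \<tau>)) y u) \<le> B * (1 + \<bar>y\<bar>) ^ d * inverse (1 + u\<^sup>2)"
    proof (cases "s * u \<in> {-pi..pi}")
      case False
      then show ?thesis using B0 u_pos by (simp add: scaled_integrand_def s_def)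
    next
      case True
      \<comment> \<open>Both pieces, 1 - exp(-isu) and s y exp(-isu), are of order s, so division by
        s leaves a bound free of \<tau>.\<close>
      have "norm (1 - of_real (1 - s * y) * cis (- (s * u))) \<le> norm (1 - cis (- (s * u))) + norm (of_real (s * y) * cis (- (s * u)))"
        by (rule order_trans[OF _ norm_triangle_ineq]) (simp add: algebra_simps)
      also have "norm (1 - cis (- (s * u))) \<le> s * \<bar>u\<bar>"
        using iexp_approx1[of "- (s * u)" 0] s by (simp add: cis_conv_exp norm_minus_commute abs_mult)
      also have "norm (of_real (s * y) * cis (- (s * u))) = s * \<bar>y\<bar>"
        using s by (simp add: norm_mult abs_mult)
      also have "s * \<bar>u\<bar> + s * \<bar>y\<bar> \<le> s * ((1 + \<bar>u\<bar>) * (1 + \<bar>y\<bar>))"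
        using s by (simp add: algebra_simps)
      finally have "norm ((1 - of_real (1 - s * y) * cis (- (s * u))) / of_real s) \<le> (1 + \<bar>u\<bar>) * (1 + \<bar>y\<bar>)"
        using s by (simp add: norm_divide divide_le_eq mult_ac)
      then have 1: "norm ((1 - of_real (1 - s * y) * cis (- (s * u))) / of_real s) ^ d \<le> ((1 + \<bar>u\<bar>) * (1 + \<bar>y\<bar>)) ^ d"
        by (intro power_mono) auto
      have 2: "norm (exp (log_gf \<tau> (s * u) - log_gf \<tau> 0 - \<i> * of_real (real n * (s * u)))) = exp (- log_fluct \<tau> (s * u))"
        using \<tau> by (simp add: Re_log_gf log_gf_0)
      have 3: "exp (- log_fluct \<tau> (s * u)) * (1 + \<bar>u\<bar>) ^ (d + 2) \<le> B"
      proof -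
        have "\<bar>u / sqrt (log_moment 2 \<tau>)\<bar> \<le> pi" using True by (auto simp: s_def abs_le_iff)
        from B[OF \<tau> this] show ?thesis by (simp add: s_def)
      qed
      have 4: "1 + u\<^sup>2 \<le> (1 + \<bar>u\<bar>) ^ 2" by (simp add: power2_eq_square algebra_simps)
      have "norm (scaled_integrand d n \<tau> s y u) * (1 + u\<^sup>2)
          = exp (- log_fluct \<tau> (s * u)) * norm ((1 - of_real (1 - s * y) * cis (- (s * u))) / of_real s) ^ d * (1 + u\<^sup>2)"
        unfolding scaled_integrand_def norm_scaleR norm_mult norm_power 2 using True by simp
      also have "\<dots> \<le> exp (- log_fluct \<tau> (s * u)) * ((1 + \<bar>u\<bar>) * (1 + \<bar>y\<bar>)) ^ d * (1 + \<bar>u\<bar>) ^ 2"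
        using 1 4 by (intro mult_mono) auto
      also have "\<dots> = (exp (- log_fluct \<tau> (s * u)) * (1 + \<bar>u\<bar>) ^ (d + 2)) * (1 + \<bar>y\<bar>) ^ d"
        by (simp add: power_mult_distrib power_add power2_eq_square)
      also have "\<dots> \<le> B * (1 + \<bar>y\<bar>) ^ d"
        using 3 by (intro mult_right_mono) auto
      finally show ?thesis using u_pos by (simp add: s_def field_simps)
    qed
  qed
qed

section \<open>Passage to the limit and conclusion\<close>

lemma lborel_integrable_inverse_1_plus_square: "integrable lborel (\<lambda>u::real. inverse (1 + u\<^sup>2))"
  using integrable_inverse_1_plus_square by (simp add: set_integrable_def)

theorem scaled_integral_limit:
  fixes \<tau> :: "nat \<Rightarrow> real"
  assumes pos: "\<And>n. \<tau> n > 0" and lim: "\<tau> \<longlonglongrightarrow> 0"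
    and saddle: "\<And>n. n > 0 \<Longrightarrow> log_moment 1 (\<tau> n) = real n"
  defines "s \<equiv> \<lambda>n. 1 / sqrt (log_moment 2 (\<tau> n))"
  shows "(\<lambda>n. integral\<^sup>L lborel (scaled_integrand d n (\<tau> n) (s n) y)) \<longlonglongrightarrow>
    of_real (sqrt (2 * pi) * poly (hermite d) y)"
proof -
  obtain B where B: "\<And>\<tau> n u. 0 < \<tau> \<Longrightarrow> \<tau> \<le> 1 / 2 \<Longrightarrow>
    norm (scaled_integrand d n \<tau> (1 / sqrt (log_moment 2 \<tau>)) y u) \<le> B * inverse (1 + u\<^sup>2)"
    using scaled_integrand_bound[of d y] by blast
  obtain N where N: "\<And>n. n \<ge> N \<Longrightarrow> \<tau> n \<le> 1 / 2"
    using order_tendstoD(2)[OF lim, of "1 / 2"] by (force simp: eventually_sequentially)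
  define f where "f = (\<lambda>u::real. exp (- (of_real u)\<^sup>2 / 2) * (of_real y + \<i> * of_real u) ^ d :: complex)"
  have meas: "scaled_integrand d n (\<tau> n) (s n) y \<in> borel_measurable lborel" if n: "n \<ge> N" for n
  proof -
    have "log_moment 2 (\<tau> n) > 0"
      using pos[of n] N[OF n] by (intro less_le_trans[OF _ log_moment_2_ge]) auto
    then have "s n > 0" by (simp add: s_def)
    then obtain x where "has_bochner_integral lborel (scaled_integrand d n (\<tau> n) (s n) y) x"
      using jensen_scaled_integral[OF pos, of "s n"] by metis
    then show ?thesis by (auto simp: has_bochner_integral_iff)
  qed
  \<comment> \<open>The shift by \<open>N\<close> makes the majorant, which requires \<tau> \<le> 1
    / 2, valid for every member of the sequence.\<close>
  have "(\<lambda>n. integral\<^sup>L lborel (scaled_integrand d (n + N) (\<tau> (n + N)) (s (n + N)) y)) \<longlonglongrightarrow> integral\<^sup>L lborel f"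
  proof (rule integral_dominated_convergence[where w = "\<lambda>u. B * inverse (1 + u\<^sup>2)"])
    show "f \<in> borel_measurable lborel" unfolding f_def by measurable
    show "integrable lborel (\<lambda>u. B * inverse (1 + u\<^sup>2))"
      by (intro integrable_mult_right lborel_integrable_inverse_1_plus_square)
    show "AE u in lborel. (\<lambda>n. scaled_integrand d (n + N) (\<tau> (n + N)) (s (n + N)) y u) \<longlonglongrightarrow> f u"
      using LIMSEQ_ignore_initial_segment[OF scaled_integrand_limit[OF pos lim saddle, of d y], of N]
      by (auto simp: f_def s_def)
    show "AE u in lborel. norm (scaled_integrand d (n + N) (\<tau> (n + N)) (s (n + N)) y u) \<le> B * inverse (1 + u\<^sup>2)" for n
      using B[OF pos N] by (auto simp: s_def)
  qed (use meas in simp)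
  then have "(\<lambda>n. integral\<^sup>L lborel (scaled_integrand d n (\<tau> n) (s n) y)) \<longlonglongrightarrow> integral\<^sup>L lborel f"
    by (rule LIMSEQ_offset)
  also have "f = (\<lambda>u. of_real (sqrt (2 * pi)) * (of_real (std_normal_density u) * (of_real y + \<i> * of_real u) ^ d))"
    by (auto simp: f_def std_normal_density_def fun_eq_iff simp flip: exp_of_real)
  also have "integral\<^sup>L lborel \<dots> = of_real (sqrt (2 * pi) * poly (hermite d) y)"
    by (simp add: std_normal_integral_hermite)
  finally show ?thesis .
qed

lemma saddle_points:
  obtains \<tau> :: "nat \<Rightarrow> real" where "\<And>n. \<tau> n > 0" "\<tau> \<longlonglongrightarrow> 0" "\<And>n. n > 0 \<Longrightarrow> log_moment 1 (\<tau> n) = real n"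
proof -
  have "\<exists>\<tau>>0. n > 0 \<longrightarrow> log_moment 1 \<tau> = real n" for n
  proof (cases "n > 0")
    case True
    then show ?thesis by (rule saddle_point_exists) blast
  \<comment> \<open>At n = 0 there is no saddle point equation; the value 1 is a
    placeholder.\<close>
  qed (auto intro: exI[of _ 1])
  then obtain \<tau> where \<tau>: "\<And>n. \<tau> n > 0" "\<And>n. n > 0 \<Longrightarrow> log_moment 1 (\<tau> n) = real n"
    by metis
  define K where "K = moment_const 1"
  have "\<tau> \<longlonglongrightarrow> 0"
  proof (rule tendsto_sandwich[of "\<lambda>_. 0" \<tau> sequentially "\<lambda>n. sqrt (K / real n)" 0])
    show "\<forall>\<^sub>F n in sequentially. \<tau> n \<le> sqrt (K / real n)"
      using eventually_gt_at_top[of 0]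
    proof eventually_elim
      case (elim n)
      \<comment> \<open>The saddle point equation and the upper bound for the first moment force
        \<tau> to be of order at most n^(-1/2).\<close>
      have "real n \<le> K / (\<tau> n)\<^sup>2"
        using log_moment_le[OF \<tau>(1), of 1 n] \<tau>(2)[OF elim] by (simp add: K_def power2_eq_square)
      then have "(\<tau> n)\<^sup>2 \<le> K / real n"
        using \<tau>(1)[of n] elim by (simp add: field_simps)
      then show ?case by (rule real_le_rsqrt)
    qed
    show "(\<lambda>n. sqrt (K / real n)) \<longlonglongrightarrow> 0"
      using tendsto_real_sqrt[OF lim_const_over_n[of K]] by simp
  qed (use \<tau>(1) in \<open>auto intro!: always_eventually less_imp_le\<close>)
  with \<tau> show ?thesis by (intro that)
qed

lemma degree_jensen_poly_le: "degree (jensen_poly t d n) \<le> d"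
  unfolding jensen_poly_def by (intro degree_sum_le) (auto intro: order_trans[OF degree_monom_le])

theorem theorem2p5:
  fixes d :: nat
  assumes "d \<ge> 3"
  shows "finite {n :: nat. \<not> hyperbolic (jensen_poly cubic_overpartition d n)}"
proof -
  obtain y :: "nat \<Rightarrow> real" where y_less: "\<And>i. i < d \<Longrightarrow> y i < y (Suc i)"
    and y_alt: "\<And>i. i \<le> d \<Longrightarrow> (-1) ^ (d + i) * poly (hermite d) (y i) > 0"
    using hermite_alternating[of d] by blast
  obtain \<tau> :: "nat \<Rightarrow> real" where pos: "\<And>n. \<tau> n > 0" and lim: "\<tau> \<longlonglongrightarrow> 0"
    and saddle: "\<And>n. n > 0 \<Longrightarrow> log_moment 1 (\<tau> n) = real n"
    by (rule saddle_points) blast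
  define s where "s = (\<lambda>n. 1 / sqrt (log_moment 2 (\<tau> n)))"
  define J where "J = (\<lambda>n. jensen_poly cubic_overpartition d n)"
  \<comment> \<open>The test points for the Jensen polynomial; they increase with \<open>y i\<close>
    because \<open>- r * (1 - s * y)\<close> has slope \<open>r * s > 0\<close> in y.\<close>
  define x where "x = (\<lambda>n i. - exp (- \<tau> n) * (1 - s n * y i))"
  have "\<forall>\<^sub>F n in sequentially. \<tau> n \<le> 1 / 2"
    using order_tendstoD(2)[OF lim, of "1 / 2"] by (auto elim: eventually_mono)
  then have s_pos: "\<forall>\<^sub>F n in sequentially. s n > 0"
  proof eventually_elim
    case (elim n)
    then have "log_moment 2 (\<tau> n) > 0"
      using pos[of n] by (intro less_le_trans[OF _ log_moment_2_ge]) auto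
    then show ?case by (simp add: s_def)
  qed
  have "\<forall>\<^sub>F n in sequentially. (-1) ^ (d + i) * poly (J n) (x n i) > 0" if i: "i \<le> d" for i
  proof -
    define I where "I = (\<lambda>n. integral\<^sup>L lborel (scaled_integrand d n (\<tau> n) (s n) (y i)))"
    have "I \<longlonglongrightarrow> of_real (sqrt (2 * pi) * poly (hermite d) (y i))"
      unfolding I_def s_def by (rule scaled_integral_limit[OF pos lim saddle])
    then have "(\<lambda>n. (-1) ^ (d + i) * Re (I n)) \<longlonglongrightarrow> (-1) ^ (d + i) * Re (of_real (sqrt (2 * pi) * poly (hermite d) (y i)))"
      by (intro tendsto_intros)
    moreover have "(-1) ^ (d + i) * Re (of_real (sqrt (2 * pi) * poly (hermite d) (y i))) > 0"
    proof -
      have "0 < sqrt (2 * pi) * ((-1) ^ (d + i) * poly (hermite d) (y i))"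
        by (intro mult_pos_pos y_alt i) simp
      then show ?thesis by (simp add: mult_ac)
    qed
    ultimately have "\<forall>\<^sub>F n in sequentially. (-1) ^ (d + i) * Re (I n) > 0"
      by (rule order_tendstoD(1))
    with s_pos show ?thesis
    proof eventually_elim
      case (elim n)
      obtain c where c: "c > 0" and "\<And>y. has_bochner_integral lborel (scaled_integrand d n (\<tau> n) (s n) y)
          (of_real (c * poly (jensen_poly cubic_overpartition d n) (- exp (- \<tau> n) * (1 - s n * y))))"
        using jensen_scaled_integral[OF pos elim(1)] by blast
      then have "I n = of_real (c * poly (J n) (x n i))"
        unfolding I_def J_def x_def by (intro has_bochner_integral_integral_eq)
      with elim(2) have "c * ((-1) ^ (d + i) * poly (J n) (x n i)) > 0" by (simp add: mult_ac)
      with c show ?case by (simp add: zero_less_mult_iff)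
    qed
  qed
  \<comment> \<open>Only \<open>d + 1\<close> test points occur, so from some n on all the signs are
    right simultaneously.\<close>
  then have "\<forall>\<^sub>F n in sequentially. \<forall>i\<in>{..d}. (-1) ^ (d + i) * poly (J n) (x n i) > 0"
    by (intro eventually_ball_finite) auto
  with s_pos have "\<forall>\<^sub>F n in sequentially. hyperbolic (J n)"
  proof eventually_elim
    case (elim n)
    show ?case
    proof (rule hyperbolicI_alternating)
      show "degree (J n) \<le> d" unfolding J_def by (rule degree_jensen_poly_le)
      show "d > 0" using assms by simp
      fix i assume i: "i < d"
      show "x n i < x n (Suc i)"
        using y_less[OF i] elim(1) by (simp add: x_def)
      have "0 < ((-1) ^ (d + i) * poly (J n) (x n i)) * ((-1) ^ (d + Suc i) * poly (J n) (x n (Suc i)))"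
        using elim(2)[rule_format, of i] elim(2)[rule_format, of "Suc i"] i by (simp only: mult_pos_pos atMost_iff)
      also have "\<dots> = ((-1) ^ (d + i))\<^sup>2 * - (poly (J n) (x n i) * poly (J n) (x n (Suc i)))"
        by (simp add: power2_eq_square)
      finally show "poly (J n) (x n i) * poly (J n) (x n (Suc i)) < 0"
        by (simp flip: power_mult)
    qed
  qed
  then show ?thesis
    by (simp add: J_def eventually_cofinite flip: cofinite_eq_sequentially)
qed

end
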